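(* Let $M$ be a smooth orientable manifold of dimension $n$ endowed with a volume form $\Omega$, and let $X$ be a smooth vector field on $M$. Assume that the following three conditions hold: (i) There exist a smooth vector field $Y$ on $M$ and two functions $\lambda,\mu\in C^\infty(M)$ such that $[X,Y]=\lambda X+\mu Y$. (ii) $X$ admits an integrating factor $f\in C^\infty(M)$, i.e. $\operatorname{div}_\Omega(fX)=0$. (iii) The function $f\mu$ is an integrating factor of $Y$, i.e. $\operatorname{div}_\Omega(f\mu Y)=0$. Then the function $$H:=\frac{L_Y f}{f}+\operatorname{div}_\Omega(Y)-\lambda$$ is a smooth first integral of the vector field $X$ in the open set $U:=M\setminus Z_f$, where $Z_f:=\{p\in M: f(p)=0\}$; that is, $H\in C^\infty(U)$ and $L_X(H)=0$ on $U$.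
   Context: Everything is in the $C^\infty$ category. $L_X$ denotes the Lie derivative with respect to a vector field $X$, and $[X,Y]=L_X(Y)$ is the Lie bracket. The divergence $\operatorname{div}_\Omega(X)$ of a vector field $X$ with respect to the volume form $\Omega$ is the function defined by $L_X(\Omega)=\operatorname{div}_\Omega(X)\,\Omega$. A function $g\in C^\infty(M)$ is an integrating factor of a vector field $X$ (with respect to $\Omega$) if $\operatorname{div}_\Omega(gX)=0$. For an open subset $U\subseteq M$, a function $H\in C^\infty(U)$ is a first integral of $X$ in $U$ if $L_X(H)=0$ on $U$ (constant functions are allowed). *)

theory Defs
  imports "HOL-Analysis.Analysis"
begin

section \<open>Smooth maps between normed vector spaces\<close>

text \<open>
  Both predicates are meant for open sets. On a finite-dimensional domain, continuity of all iterated
  directional derivatives is the usual notion of being \<open>k\<close> times continuously differentiable.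
\<close>

primrec C_diff_on :: "nat \<Rightarrow> ('e::real_normed_vector \<Rightarrow> 'b::real_normed_vector) \<Rightarrow> 'e set \<Rightarrow> bool" where
  "C_diff_on 0 h S \<longleftrightarrow> continuous_on S h"
| "C_diff_on (Suc k) h S \<longleftrightarrow>
     (\<forall>x\<in>S. h differentiable (at x)) \<and>
     (\<forall>d. C_diff_on k (\<lambda>x. frechet_derivative h (at x) d) S)"

definition smooth_map_on :: "('e::real_normed_vector \<Rightarrow> 'b::real_normed_vector) \<Rightarrow> 'e set \<Rightarrow> bool" where
  "smooth_map_on h S \<longleftrightarrow> (\<forall>k. C_diff_on k h S)"

section \<open>Smooth manifolds\<close>

text \<open>
  The manifold is the whole type \<open>'a\<close>, a second countable Hausdorff space, and its dimension is
  \<open>CARD('n)\<close>. A chart is a pair of a domain and a coordinate map; only the values of the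
  coordinate map on the domain matter.
\<close>

type_synonym ('a, 'n) chart = "'a set \<times> ('a \<Rightarrow> real ^ 'n)"

definition is_chart :: "('a::topological_space, 'n::finite) chart \<Rightarrow> bool" where
  "is_chart c \<longleftrightarrow> (case c of (U, \<phi>) \<Rightarrow>
     open U \<and> open (\<phi> ` U) \<and> homeomorphism U (\<phi> ` U) \<phi> (inv_into U \<phi>))"

definition smooth_transition :: "('a, 'n::finite) chart \<Rightarrow> ('a, 'n) chart \<Rightarrow> bool" where
  "smooth_transition c d \<longleftrightarrow> (case (c, d) of ((U, \<phi>), (V, \<psi>)) \<Rightarrow>
     smooth_map_on (\<psi> \<circ> inv_into U \<phi>) (\<phi> ` (U \<inter> V)))"

text \<open>
  The atlas need not be maximal. All notions below depend only on the smooth structure it generates.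
\<close>

definition smooth_atlas :: "('a::{t2_space, second_countable_topology}, 'n::finite) chart set \<Rightarrow> bool" where
  "smooth_atlas A \<longleftrightarrow>
     (\<forall>c\<in>A. is_chart c) \<and> (\<Union>c\<in>A. fst c) = UNIV \<and> (\<forall>c\<in>A. \<forall>d\<in>A. smooth_transition c d)"

definition smooth_fun_on ::
    "('a::topological_space, 'n::finite) chart set \<Rightarrow> 'a set \<Rightarrow> ('a \<Rightarrow> real) \<Rightarrow> bool" where
  "smooth_fun_on A W h \<longleftrightarrow>
     open W \<and> (\<forall>(U, \<phi>)\<in>A. smooth_map_on (h \<circ> inv_into U \<phi>) (\<phi> ` (U \<inter> W)))"

definition smooth_near ::
    "('a::topological_space, 'n::finite) chart set \<Rightarrow> 'a \<Rightarrow> ('a \<Rightarrow> real) \<Rightarrow> bool" where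
  "smooth_near A p h \<longleftrightarrow> (\<exists>W. p \<in> W \<and> smooth_fun_on A W h)"

section \<open>Tangent vectors and vector fields\<close>

text \<open>
  A tangent vector at \<open>p\<close> is a derivation of the algebra of germs at \<open>p\<close> of smooth functions. A germ is
  represented by functions on all of \<open>'a\<close> that are smooth near \<open>p\<close>. The first conjunct
  makes tangent vectors with the same action on germs equal, the second one makes them act on germs.
\<close>

type_synonym 'a tvec = "('a \<Rightarrow> real) \<Rightarrow> real"

definition tangent_space ::
    "('a::topological_space, 'n::finite) chart set \<Rightarrow> 'a \<Rightarrow> 'a tvec set" where
  "tangent_space A p = {v.
     (\<forall>g. \<not> smooth_near A p g \<longrightarrow> v g = 0) \<and>
     (\<forall>g h. smooth_near A p g \<and> smooth_near A p h \<and> eventually (\<lambda>q. g q = h q) (nhds p)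
        \<longrightarrow> v g = v h) \<and>
     (\<forall>g h a b. smooth_near A p g \<and> smooth_near A p h
        \<longrightarrow> v (\<lambda>q. a * g q + b * h q) = a * v g + b * v h) \<and>
     (\<forall>g h. smooth_near A p g \<and> smooth_near A p h
        \<longrightarrow> v (\<lambda>q. g q * h q) = g p * v h + h p * v g)}"

type_synonym 'a vfield = "'a \<Rightarrow> 'a tvec"

definition smooth_vfield_on ::
    "('a::topological_space, 'n::finite) chart set \<Rightarrow> 'a set \<Rightarrow> 'a vfield \<Rightarrow> bool" where
  "smooth_vfield_on A W X \<longleftrightarrow>
     open W \<and> (\<forall>p\<in>W. X p \<in> tangent_space A p) \<and>
     (\<forall>V h. V \<subseteq> W \<and> smooth_fun_on A V h \<longrightarrow> smooth_fun_on A V (\<lambda>p. X p h))"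

definition vf_add :: "'a vfield \<Rightarrow> 'a vfield \<Rightarrow> 'a vfield" where
  "vf_add X Y = (\<lambda>p h. X p h + Y p h)"

definition vf_scale :: "('a \<Rightarrow> real) \<Rightarrow> 'a vfield \<Rightarrow> 'a vfield" where
  "vf_scale g X = (\<lambda>p h. g p * X p h)"

section \<open>Differential forms\<close>

text \<open>
  The \<open>CARD('k)\<close> arguments of a form are indexed by the finite type \<open>'k\<close>. Values on families that do
  not consist of tangent vectors at the point in question are irrelevant.
\<close>

type_synonym ('a, 'k) form = "'a \<Rightarrow> ('k \<Rightarrow> 'a tvec) \<Rightarrow> real"

definition alternating_multilinear :: "'a tvec set \<Rightarrow> (('k::finite \<Rightarrow> 'a tvec) \<Rightarrow> real) \<Rightarrow> bool" where
  "alternating_multilinear T w \<longleftrightarrow>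
     (\<forall>v i x y a b. range v \<subseteq> T \<and> x \<in> T \<and> y \<in> T
        \<longrightarrow> w (v(i := (\<lambda>h. a * x h + b * y h))) = a * w (v(i := x)) + b * w (v(i := y))) \<and>
     (\<forall>v i j. range v \<subseteq> T \<and> i \<noteq> j \<and> v i = v j \<longrightarrow> w v = 0)"

definition smooth_form ::
    "('a::topological_space, 'n::finite) chart set \<Rightarrow> ('a, 'k::finite) form \<Rightarrow> bool" where
  "smooth_form A \<omega> \<longleftrightarrow>
     (\<forall>p. alternating_multilinear (tangent_space A p) (\<omega> p)) \<and>
     (\<forall>W Y. open W \<and> (\<forall>i. smooth_vfield_on A W (Y i)) \<longrightarrow> smooth_fun_on A W (\<lambda>p. \<omega> p (\<lambda>i. Y i p)))"

definition volume_form ::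
    "('a::topological_space, 'n::finite) chart set \<Rightarrow> ('a, 'n) form \<Rightarrow> bool" where
  "volume_form A \<Omega> \<longleftrightarrow>
     smooth_form A \<Omega> \<and> (\<forall>p. \<exists>v. range v \<subseteq> tangent_space A p \<and> \<Omega> p v \<noteq> 0)"

section \<open>Lie derivatives and divergence\<close>

definition lie_fun :: "'a vfield \<Rightarrow> ('a \<Rightarrow> real) \<Rightarrow> 'a \<Rightarrow> real" where
  "lie_fun X h = (\<lambda>p. X p h)"

text \<open>
  The conditional only ensures the normalization required of members of the tangent space.
\<close>

definition lie_bracket ::
    "('a::topological_space, 'n::finite) chart set \<Rightarrow> 'a vfield \<Rightarrow> 'a vfield \<Rightarrow> 'a vfield" where
  "lie_bracket A X Y = (\<lambda>p h.
     if smooth_near A p h then X p (lie_fun Y h) - Y p (lie_fun X h) else 0)"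

text \<open>
  The Lie derivative of a form is given by
  \[ (L_X \omega)(Y_1, \ldots, Y_k) =
     X(\omega(Y_1, \ldots, Y_k)) - \sum_i \omega(Y_1, \ldots, [X, Y_i], \ldots, Y_k). \]
  At \<open>p\<close> the right-hand side depends only on the values of the local smooth fields \<open>Y i\<close> at
  \<open>p\<close>, and it is this common value that the definite description selects.
\<close>

definition lie_form ::
    "('a::topological_space, 'n::finite) chart set \<Rightarrow> 'a vfield \<Rightarrow> ('a, 'k::finite) form \<Rightarrow> ('a, 'k) form"
  where
  "lie_form A X \<omega> = (\<lambda>p v. THE c. \<forall>W Y.
     p \<in> W \<and> (\<forall>i. smooth_vfield_on A W (Y i)) \<and> (\<forall>i. Y i p = v i) \<longrightarrow>
     c = X p (\<lambda>q. \<omega> q (\<lambda>i. Y i q))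
         - (\<Sum>i\<in>UNIV. \<omega> p ((\<lambda>j. Y j p)(i := lie_bracket A X (Y i) p))))"

definition divergence ::
    "('a::topological_space, 'n::finite) chart set \<Rightarrow> ('a, 'n) form \<Rightarrow> 'a vfield \<Rightarrow> 'a \<Rightarrow> real" where
  "divergence A \<Omega> X = (THE g. \<forall>p v. range v \<subseteq> tangent_space A p \<longrightarrow>
     lie_form A X \<Omega> p v = g p * \<Omega> p v)"

definition integrating_factor ::
    "('a::topological_space, 'n::finite) chart set \<Rightarrow> ('a, 'n) form \<Rightarrow> 'a vfield \<Rightarrow> ('a \<Rightarrow> real) \<Rightarrow> bool"
  where
  "integrating_factor A \<Omega> X g \<longleftrightarrow>
     smooth_fun_on A UNIV g \<and> (\<forall>p. divergence A \<Omega> (vf_scale g X) p = 0)"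

definition first_integral_on ::
    "('a::topological_space, 'n::finite) chart set \<Rightarrow> 'a set \<Rightarrow> 'a vfield \<Rightarrow> ('a \<Rightarrow> real) \<Rightarrow> bool" where
  "first_integral_on A U X H \<longleftrightarrow> smooth_fun_on A U H \<and> (\<forall>p\<in>U. lie_fun X H p = 0)"

end

theory Submission
  imports Defs
begin

text \<open>
  On the set where \<open>f\<close> does not vanish, \<open>H = Y (ln \<bar>f\<bar>) + div Y - \<lambda>\<close>, and \<open>X H = 0\<close> is a computation
  with two rules of the divergence:

    \<^item> \<open>div (g X) = g div X + X g\<close> (\<open>divergence_scale\<close>),
    \<^item> \<open>div [X, Y] = X (div Y) - Y (div X)\<close> (\<open>divergence_lie_bracket\<close>).

  Indeed \<open>X (Y (ln \<bar>f\<bar>)) = [X, Y] (ln \<bar>f\<bar>) + Y (X (ln \<bar>f\<bar>))\<close>. That \<open>f X\<close> has divergence zero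
  means \<open>X (ln \<bar>f\<bar>) = - div X\<close>, so by the assumption on \<open>[X, Y]\<close> the left-hand side equals
  \<open>- \<lambda> div X + \<mu> Y (ln \<bar>f\<bar>) - Y (div X)\<close>. On the other hand, by the two rules and the same assumption,
  \<open>X (div Y) - Y (div X) = \<lambda> div X + X \<lambda> + \<mu> div Y + Y \<mu>\<close>. Adding up and subtracting \<open>X \<lambda>\<close>,
  everything cancels except \<open>\<mu> Y (ln \<bar>f\<bar>) + \<mu> div Y + Y \<mu>\<close>, which is \<open>div (f \<mu> Y) / f\<close>
  and vanishes because \<open>f \<mu>\<close> is an integrating factor of \<open>Y\<close>. This is \<open>first_integral_formula\<close>.

  Most of the work lies in deriving the two rules from the definitions. The Lie derivative of the
  volume form and the divergence are definite descriptions, and both have to be shown to describe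
  something. Hadamard's lemma shows that the coordinate derivatives at a point span all
  derivations of germs (\<open>tangent_coord_expansion\<close>), so every point has a neighbourhood with a smooth frame
  \<open>E\<close>. Expanding in a frame shows that the formula for \<open>L\<^sub>X \<omega>\<close> is linear over the smooth functions
  in each field inserted (\<open>lie_form_along_slot\<close>), hence depends only on the values of the fields at the point
  (\<open>lie_form_along_pointwise\<close>) and is again alternating (\<open>lie_form_alternating\<close>). Alternating forms of
  top degree are determined by their value on one basis, so \<open>L\<^sub>X \<Omega>\<close> is a multiple of \<open>\<Omega>\<close>.
  What remains of the definitions is one identity (\<open>derivative_of_vol\<close>):
  \<open>X (\<Omega>(Y\<^sub>1, \<dots>, Y\<^sub>n)) = div X \<Omega>(Y\<^sub>1, \<dots>, Y\<^sub>n) + \<Sum>\<^sub>i \<Omega>(Y\<^sub>1, \<dots>, [X, Y\<^sub>i], \<dots>, Y\<^sub>n)\<close>.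
  The first rule follows by inserting \<open>[g X, E\<^sub>i] = g [X, E\<^sub>i] - E\<^sub>i(g) X\<close>; the second by applying the
  identity twice and antisymmetrizing, where the Jacobi identity takes care of the second-order terms.
\<close>

section \<open>Calculus of smooth maps between normed spaces\<close>

lemma C_diff_on_cong:
  assumes "open S" "\<And>x. x \<in> S \<Longrightarrow> f x = g x" "C_diff_on k f S"
  shows "C_diff_on k g S"
  using assms(2,3)
proof (induction k arbitrary: f g)
  case 0
  then show ?case by (simp cong: continuous_on_cong)
next
  case (Suc k)
  have d: "f differentiable at x" if "x \<in> S" for x using Suc.prems(2) that by simp
  have eq: "frechet_derivative f (at x) = frechet_derivative g (at x)" if "x \<in> S" for x
    using frechet_derivative_transform_within_open[OF d[OF that] \<open>open S\<close> that] Suc.prems(1) by blast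
  have "g differentiable at x" if x: "x \<in> S" for x
    using d[OF x] has_derivative_transform_within_open[where f = f and g = g, OF _ \<open>open S\<close> x Suc.prems(1)]
    unfolding differentiable_def by blast
  moreover have "C_diff_on k (\<lambda>x. frechet_derivative g (at x) d) S" for d
  proof (rule Suc.IH)
    show "C_diff_on k (\<lambda>x. frechet_derivative f (at x) d) S" using Suc.prems(2) by simp
  qed (simp add: eq)
  ultimately show ?case by simp
qed

lemma C_diff_on_SucD:
  assumes "C_diff_on (Suc k) h S" "x \<in> S"
  shows "(h has_derivative frechet_derivative h (at x)) (at x)"
  using assms frechet_derivative_works by auto

text \<open>
  Computing with an explicit derivative \<open>h'\<close> instead of \<open>frechet_derivative h\<close> lets each closure
  property below be proved by induction on the order, from the corresponding differentiation rule.
\<close>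

lemma C_diff_on_SucI:
  assumes "open S" "\<And>x. x \<in> S \<Longrightarrow> (h has_derivative h' x) (at x)"
    and "\<And>d. C_diff_on k (\<lambda>x. h' x d) S"
  shows "C_diff_on (Suc k) h S"
proof -
  have "C_diff_on k (\<lambda>x. frechet_derivative h (at x) d) S" for d
    by (rule C_diff_on_cong[OF assms(1) _ assms(3)[of d]])
      (use frechet_derivative_at[OF assms(2)] in auto)
  with assms(2) show ?thesis by (auto simp: differentiable_def)
qed

lemma C_diff_on_Suc_imp: "C_diff_on (Suc k) h S \<Longrightarrow> C_diff_on k h S"
proof (induction k arbitrary: h)
  case 0
  then have "\<forall>x\<in>S. isCont h x" by (auto intro: differentiable_imp_continuous_within)
  then show ?case by (simp add: continuous_at_imp_continuous_on)
next
  case (Suc k)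
  from Suc.prems show ?case by (auto intro: Suc.IH)
qed

lemma C_diff_on_subset: "C_diff_on k h S \<Longrightarrow> T \<subseteq> S \<Longrightarrow> C_diff_on k h T"
  by (induction k arbitrary: h) (auto intro: continuous_on_subset)

lemma C_diff_on_local:
  assumes "\<And>x. x \<in> S \<Longrightarrow> \<exists>T. open T \<and> x \<in> T \<and> C_diff_on k h T"
  shows "C_diff_on k h S"
  using assms
proof (induction k arbitrary: h)
  case 0
  have "isCont h x" if "x \<in> S" for x
    using 0[OF that] by (auto simp: continuous_on_eq_continuous_at)
  then show ?case by (simp add: continuous_at_imp_continuous_on)
next
  case (Suc k)
  have "C_diff_on k (\<lambda>x. frechet_derivative h (at x) d) S" for d
  proof (rule Suc.IH)
    fix x assume "x \<in> S"
    from Suc.prems[OF this] show "\<exists>T. open T \<and> x \<in> T \<and> C_diff_on k (\<lambda>x. frechet_derivative h (at x) d) T"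
      by auto
  qed
  moreover have "h differentiable at x" if "x \<in> S" for x using Suc.prems[OF that] by auto
  ultimately show ?case by simp
qed

lemma C_diff_on_const: "open S \<Longrightarrow> C_diff_on k (\<lambda>x. c) S"
  by (induction k arbitrary: c) auto

lemma C_diff_on_bounded_linear_compose:
  assumes "open S" "bounded_linear L"
  shows "C_diff_on k f S \<Longrightarrow> C_diff_on k (\<lambda>x. L (f x)) S"
proof (induction k arbitrary: f)
  case 0
  then show ?case
    using bounded_linear.continuous_on[OF assms(2)] by simp
next
  case (Suc k)
  show ?case
  proof (rule C_diff_on_SucI[OF \<open>open S\<close>])
    show "((\<lambda>x. L (f x)) has_derivative (\<lambda>d. L (frechet_derivative f (at x) d))) (at x)" if "x \<in> S" for x
      by (rule bounded_linear.has_derivative[OF assms(2) C_diff_on_SucD[OF Suc.prems that]])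
    show "C_diff_on k (\<lambda>x. L (frechet_derivative f (at x) d)) S" for d
      by (rule Suc.IH) (use Suc.prems in simp)
  qed
qed

lemma C_diff_on_ident: "open S \<Longrightarrow> C_diff_on k (\<lambda>x. x) S"
proof (cases k)
  case (Suc m)
  assume "open S"
  then show ?thesis unfolding Suc
    by (intro C_diff_on_SucI[where h' = "\<lambda>x d. d"] C_diff_on_const) (auto intro: has_derivative_ident)
qed auto

lemma C_diff_on_add:
  assumes "open S"
  shows "C_diff_on k f S \<Longrightarrow> C_diff_on k g S \<Longrightarrow> C_diff_on k (\<lambda>x. f x + g x) S"
proof (induction k arbitrary: f g)
  case 0
  then show ?case by (simp add: continuous_on_add)
next
  case (Suc k)
  show ?case
  proof (rule C_diff_on_SucI[OF assms])
    show "((\<lambda>x. f x + g x) has_derivative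
        (\<lambda>d. frechet_derivative f (at x) d + frechet_derivative g (at x) d)) (at x)" if "x \<in> S" for x
      using has_derivative_add[OF C_diff_on_SucD[OF Suc.prems(1) that] C_diff_on_SucD[OF Suc.prems(2) that]] .
    show "C_diff_on k (\<lambda>x. frechet_derivative f (at x) d + frechet_derivative g (at x) d) S" for d
      by (rule Suc.IH) (use Suc.prems in auto)
  qed
qed

lemma C_diff_on_sum:
  assumes "open S" "\<And>i. i \<in> I \<Longrightarrow> C_diff_on k (f i) S"
  shows "C_diff_on k (\<lambda>x. \<Sum>i\<in>I. f i x) S"
  using assms(2)
  by (induction I rule: infinite_finite_induct)
    (auto intro!: C_diff_on_add C_diff_on_const assms(1))

lemma C_diff_on_scaleR:
  fixes f :: "'e::real_normed_vector \<Rightarrow> real"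
  assumes "open S"
  shows "C_diff_on k f S \<Longrightarrow> C_diff_on k g S \<Longrightarrow> C_diff_on k (\<lambda>x. f x *\<^sub>R g x) S"
proof (induction k arbitrary: f g)
  case 0
  then show ?case by (simp add: continuous_on_scaleR)
next
  case (Suc k)
  show ?case
  proof (rule C_diff_on_SucI[OF assms])
    show "((\<lambda>x. f x *\<^sub>R g x) has_derivative
        (\<lambda>d. f x *\<^sub>R frechet_derivative g (at x) d + frechet_derivative f (at x) d *\<^sub>R g x)) (at x)" if "x \<in> S" for x
      using has_derivative_scaleR[OF C_diff_on_SucD[OF Suc.prems(1) that] C_diff_on_SucD[OF Suc.prems(2) that]] .
    show "C_diff_on k (\<lambda>x. f x *\<^sub>R frechet_derivative g (at x) d + frechet_derivative f (at x) d *\<^sub>R g x) S" for d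
      by (intro C_diff_on_add assms Suc.IH C_diff_on_Suc_imp[OF Suc.prems(1)] C_diff_on_Suc_imp[OF Suc.prems(2)])
        (use Suc.prems in auto)
  qed
qed

lemma C_diff_on_mult:
  fixes f g :: "'e::real_normed_vector \<Rightarrow> real"
  assumes "open S" "C_diff_on k f S" "C_diff_on k g S"
  shows "C_diff_on k (\<lambda>x. f x * g x) S"
  using C_diff_on_scaleR[OF assms] by simp

lemma C_diff_on_inverse:
  fixes f :: "'e::real_normed_vector \<Rightarrow> real"
  assumes "open S" "\<And>x. x \<in> S \<Longrightarrow> f x \<noteq> 0"
  shows "C_diff_on k f S \<Longrightarrow> C_diff_on k (\<lambda>x. inverse (f x)) S"
proof (induction k)
  case 0
  then show ?case using assms(2) by (simp add: continuous_on_inverse)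
next
  case (Suc k)
  show ?case
  proof (rule C_diff_on_SucI[OF assms(1)])
    show "((\<lambda>x. inverse (f x)) has_derivative
        (\<lambda>d. (- 1) * (inverse (f x) * frechet_derivative f (at x) d * inverse (f x)))) (at x)" if "x \<in> S" for x
      using Deriv.has_derivative_inverse[OF assms(2)[OF that] C_diff_on_SucD[OF Suc.prems that]] by simp
    have "C_diff_on k (\<lambda>x. inverse (f x)) S" by (rule Suc.IH[OF C_diff_on_Suc_imp[OF Suc.prems]])
    then show "C_diff_on k (\<lambda>x. (- 1) * (inverse (f x) * frechet_derivative f (at x) d * inverse (f x))) S" for d
      using Suc.prems by (intro C_diff_on_mult C_diff_on_const assms(1)) auto
  qed
qed

text \<open>
  The chain rule is applied to the derivative of \<open>g\<close> in the directions of a basis, since only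
  fixed directions occur in \<open>C_diff_on\<close>; this is where finite dimension of the middle space enters.
\<close>

lemma C_diff_on_compose:
  fixes f :: "'e::real_normed_vector \<Rightarrow> 'f::euclidean_space"
  assumes "open S" "open T" "f ` S \<subseteq> T"
  shows "C_diff_on k f S \<Longrightarrow> C_diff_on k g T \<Longrightarrow> C_diff_on k (\<lambda>x. g (f x)) S"
proof (induction k arbitrary: g)
  case 0
  then show ?case using continuous_on_compose2[OF _ _ assms(3)] by simp
next
  case (Suc k)
  let ?D = "\<lambda>x d. \<Sum>b\<in>Basis. (frechet_derivative f (at x) d \<bullet> b) *\<^sub>R frechet_derivative g (at (f x)) b"
  show ?case
  proof (rule C_diff_on_SucI[OF assms(1)])
    fix x assume x: "x \<in> S"
    let ?f = "frechet_derivative f (at x)" and ?g = "frechet_derivative g (at (f x))"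
    have f: "(f has_derivative ?f) (at x)" by (rule C_diff_on_SucD[OF Suc.prems(1) x])
    have g: "(g has_derivative ?g) (at (f x))"
      using C_diff_on_SucD[OF Suc.prems(2)] x assms(3) by auto
    have "?g v = (\<Sum>b\<in>Basis. (v \<bullet> b) *\<^sub>R ?g b)" for v
    proof -
      have lin: "linear ?g" using g by (simp add: has_derivative_bounded_linear bounded_linear.linear)
      have "?g v = ?g (\<Sum>b\<in>Basis. (v \<bullet> b) *\<^sub>R b)" by (simp add: euclidean_representation)
      also have "\<dots> = (\<Sum>b\<in>Basis. (v \<bullet> b) *\<^sub>R ?g b)"
        by (simp add: linear_sum[OF lin] linear_scale[OF lin])
      finally show ?thesis .
    qed
    then have "(\<lambda>d. ?g (?f d)) = ?D x" by (intro ext)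
    with has_derivative_compose[OF f g] show "((\<lambda>x. g (f x)) has_derivative ?D x) (at x)" by simp
  next
    fix d
    have 1: "C_diff_on k (\<lambda>x. frechet_derivative g (at (f x)) b) S" for b
      by (rule Suc.IH[OF C_diff_on_Suc_imp[OF Suc.prems(1)]]) (use Suc.prems(2) in simp)
    have 2: "C_diff_on k (\<lambda>x. frechet_derivative f (at x) d \<bullet> b) S" for b
      using Suc.prems by (intro C_diff_on_bounded_linear_compose[OF assms(1) bounded_linear_inner_left]) auto
    show "C_diff_on k (\<lambda>x. ?D x d) S"
      by (intro C_diff_on_sum assms(1) C_diff_on_scaleR 1 2)
  qed
qed

lemma smooth_map_on_cong:
  "open S \<Longrightarrow> (\<And>x. x \<in> S \<Longrightarrow> f x = g x) \<Longrightarrow> smooth_map_on f S \<Longrightarrow> smooth_map_on g S"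
  unfolding smooth_map_on_def using C_diff_on_cong by blast

lemma smooth_map_on_subset: "smooth_map_on h S \<Longrightarrow> T \<subseteq> S \<Longrightarrow> smooth_map_on h T"
  unfolding smooth_map_on_def using C_diff_on_subset by blast

lemma smooth_map_on_compose:
  fixes f :: "'e::real_normed_vector \<Rightarrow> 'f::euclidean_space"
  assumes "open S" "open T" "f ` S \<subseteq> T" "smooth_map_on f S" "smooth_map_on g T"
  shows "smooth_map_on (\<lambda>x. g (f x)) S"
  using assms C_diff_on_compose unfolding smooth_map_on_def by blast

lemma smooth_map_on_has_derivative:
  "smooth_map_on h S \<Longrightarrow> x \<in> S \<Longrightarrow> (h has_derivative frechet_derivative h (at x)) (at x)"
  unfolding smooth_map_on_def using C_diff_on_SucD by blast

lemma smooth_map_on_derivative: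
  assumes "smooth_map_on h S"
  shows "smooth_map_on (\<lambda>x. frechet_derivative h (at x) d) S"
  unfolding smooth_map_on_def
proof
  fix k
  from assms have "C_diff_on (Suc k) h S" unfolding smooth_map_on_def by blast
  then show "C_diff_on k (\<lambda>x. frechet_derivative h (at x) d) S" by simp
qed

section \<open>Hadamard's lemma\<close>

text \<open>
  Differentiating under the integral sign in a direction \<open>d\<close> gives an integral of the same shape, with the
  \<open>d\<close>-derivative of \<open>h\<close> in place of \<open>h\<close> and with one more factor \<open>t\<close> from the chain rule. The power
  \<open>t ^ m\<close> makes the statement general enough for induction on the order.
\<close>

lemma C_diff_on_segment_integral:
  fixes h :: "'e::euclidean_space \<Rightarrow> real"
  assumes "open S" "convex S" "a \<in> S"
  shows "(\<And>k. C_diff_on k h S) \<Longrightarrow>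
    C_diff_on k (\<lambda>x. integral {0..1} (\<lambda>t. t ^ m * h (a + t *\<^sub>R (x - a)))) S"
proof (induction k arbitrary: h m)
  have seg: "a + t *\<^sub>R (x - a) \<in> S" if "x \<in> S" "t \<in> {0..1}" for x t
  proof -
    have "a + t *\<^sub>R (x - a) = (1 - t) *\<^sub>R a + t *\<^sub>R x" by (simp add: algebra_simps)
    then show ?thesis using convexD_alt[OF assms(2,3) that(1), of t] that(2) by simp
  qed
  have cont: "continuous_on (S \<times> cbox 0 1) (\<lambda>(x, t). t ^ m * h (a + t *\<^sub>R (x - a)))"
    if "\<And>k. C_diff_on k h S" for h :: "'e \<Rightarrow> real" and m
  proof -
    have "continuous_on S h" using that[of 0] by simp
    then have "continuous_on (S \<times> cbox 0 1) (\<lambda>z. h (a + snd z *\<^sub>R (fst z - a)))"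
      by (rule continuous_on_compose2) (auto intro!: continuous_intros seg)
    then show ?thesis unfolding case_prod_unfold by (intro continuous_intros) auto
  qed
  {
    case 0
    show ?case using integral_continuous_on_param[OF cont[OF 0]] by simp
  next
    case (Suc k)
    have D: "C_diff_on j (\<lambda>x. frechet_derivative h (at x) d) S" for j d
      using Suc.prems[of "Suc j"] by simp
    have hd: "(h has_derivative frechet_derivative h (at x)) (at x)" if "x \<in> S" for x
      using C_diff_on_SucD[OF Suc.prems that] .
    define fx where "fx x t = Blinfun (\<lambda>d. t ^ Suc m * frechet_derivative h (at (a + t *\<^sub>R (x - a))) d)"
      for x t
    have fx: "blinfun_apply (fx x t) = (\<lambda>d. t ^ Suc m * frechet_derivative h (at (a + t *\<^sub>R (x - a))) d)"
      if "x \<in> S" "t \<in> {0..1}" for x t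
      unfolding fx_def
      by (intro bounded_linear_Blinfun_apply bounded_linear_const_mult
          has_derivative_bounded_linear[OF hd[OF seg[OF that]]])
    have cfx: "continuous_on (S \<times> cbox 0 1) (\<lambda>(x, t). fx x t)"
    proof (rule continuous_on_blinfun_componentwise)
      fix i :: 'e
      show "continuous_on (S \<times> cbox 0 1) (\<lambda>z. blinfun_apply (case z of (x, t) \<Rightarrow> fx x t) i)"
        by (rule continuous_on_eq[OF cont[OF D[of _ i], of "Suc m"]]) (auto simp: fx)
    qed
    have der: "((\<lambda>x. integral (cbox 0 1) (\<lambda>t. t ^ m * h (a + t *\<^sub>R (x - a)))) has_derivative
        blinfun_apply (integral (cbox 0 1) (fx x))) (at x)" if x: "x \<in> S" for x
    proof -
      have "((\<lambda>x. integral (cbox 0 1) (\<lambda>t. t ^ m * h (a + t *\<^sub>R (x - a)))) has_derivative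
        blinfun_apply (integral (cbox 0 1) (fx x))) (at x within S)"
      proof (rule leibniz_rule[OF _ _ cfx x assms(2)])
        fix y :: 'e and t :: real assume y: "y \<in> S" and t: "t \<in> cbox 0 1"
        have t': "t \<in> {0..1}" using t by simp
        have inner: "((\<lambda>y. a + t *\<^sub>R (y - a)) has_derivative (\<lambda>d. t *\<^sub>R d)) (at y)"
          by (auto intro!: derivative_eq_intros)
        have "((\<lambda>y. t ^ m * h (a + t *\<^sub>R (y - a))) has_derivative
            (\<lambda>d. t ^ m * frechet_derivative h (at (a + t *\<^sub>R (y - a))) (t *\<^sub>R d))) (at y)"
          by (intro has_derivative_mult_right has_derivative_compose[OF inner hd[OF seg[OF y t']]])
        also have "(\<lambda>d. t ^ m * frechet_derivative h (at (a + t *\<^sub>R (y - a))) (t *\<^sub>R d)) = blinfun_apply (fx y t)"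
          using linear_scale[OF bounded_linear.linear[OF has_derivative_bounded_linear[OF hd[OF seg[OF y t']]]]]
          by (auto simp: fx[OF y t'] fun_eq_iff algebra_simps)
        finally show "((\<lambda>y. t ^ m * h (a + t *\<^sub>R (y - a))) has_derivative blinfun_apply (fx y t)) (at y within S)"
          by (rule has_derivative_at_withinI)
      next
        fix y assume y: "y \<in> S"
        have "continuous_on (cbox 0 1) (\<lambda>t. case (y, t) of (x, t) \<Rightarrow> t ^ m * h (a + t *\<^sub>R (x - a)))"
          by (rule continuous_on_compose2[OF cont[OF Suc.prems]]) (auto intro!: continuous_intros y)
        then show "(\<lambda>t. t ^ m * h (a + t *\<^sub>R (y - a))) integrable_on cbox 0 1"
          by (intro integrable_continuous) simp
      qed
      then show ?thesis using at_within_open[OF x assms(1)] by simp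
    qed
    have val: "blinfun_apply (integral (cbox 0 1) (fx x)) d =
        integral {0..1} (\<lambda>t. t ^ Suc m * frechet_derivative h (at (a + t *\<^sub>R (x - a))) d)"
      if x: "x \<in> S" for x d
    proof -
      have "continuous_on (cbox 0 1) (\<lambda>t. case (x, t) of (x, t) \<Rightarrow> fx x t)"
        by (rule continuous_on_compose2[OF cfx]) (auto intro!: continuous_intros x)
      then have "fx x integrable_on cbox 0 1" by (intro integrable_continuous) simp
      then have "blinfun_apply (integral (cbox 0 1) (fx x)) d = integral (cbox 0 1) (\<lambda>t. fx x t d)"
        by (rule blinfun_apply_integral)
      also have "\<dots> = integral {0..1} (\<lambda>t. t ^ Suc m * frechet_derivative h (at (a + t *\<^sub>R (x - a))) d)"
        unfolding cbox_interval by (rule integral_cong) (simp add: fx[OF x])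
      finally show ?thesis .
    qed
    show ?case
    proof (rule C_diff_on_SucI[OF assms(1)])
      show "((\<lambda>x. integral {0..1} (\<lambda>t. t ^ m * h (a + t *\<^sub>R (x - a)))) has_derivative
        blinfun_apply (integral (cbox 0 1) (fx x))) (at x)" if "x \<in> S" for x
        using der[OF that] by (simp only: cbox_interval)
      show "C_diff_on k (\<lambda>x. blinfun_apply (integral (cbox 0 1) (fx x)) d) S" for d
        by (rule C_diff_on_cong[OF assms(1) _ Suc.IH[OF D[of _ d], of "Suc m"]])
          (simp only: val)
    qed
  }
qed

text \<open>
  Integrating the derivative of \<open>h\<close> along the segment from \<open>a\<close> to \<open>x\<close> writes \<open>h x - h a\<close> as a sum of
  products in which the first factors vanish at \<open>a\<close>. The second factors are the means of the partial
  derivatives over the segment.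
\<close>

lemma smooth_map_Hadamard:
  fixes h :: "real ^ 'n \<Rightarrow> real"
  assumes "smooth_map_on h S" "open S" "convex S" "a \<in> S"
  obtains g where "\<And>i. smooth_map_on (g i) S"
    and "\<And>x. x \<in> S \<Longrightarrow> h x = h a + (\<Sum>i\<in>UNIV. (x $ i - a $ i) * g i x)"
    and "\<And>i. g i a = frechet_derivative h (at a) (axis i 1)"
proof -
  have C: "C_diff_on k h S" for k using assms(1) by (simp add: smooth_map_on_def)
  have hd: "(h has_derivative frechet_derivative h (at x)) (at x)" if "x \<in> S" for x
    using C_diff_on_SucD[OF C that] .
  have D: "C_diff_on k (\<lambda>x. frechet_derivative h (at x) d) S" for k d
    using C[of "Suc k"] by simp
  have seg: "a + t *\<^sub>R (x - a) \<in> S" if "x \<in> S" "t \<in> {0..1}" for x t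
  proof -
    have "a + t *\<^sub>R (x - a) = (1 - t) *\<^sub>R a + t *\<^sub>R x" by (simp add: algebra_simps)
    then show ?thesis using convexD_alt[OF assms(3,4) that(1), of t] that(2) by simp
  qed
  define g where "g i x = integral {0..1} (\<lambda>t. frechet_derivative h (at (a + t *\<^sub>R (x - a))) (axis i 1))"
    for i :: 'n and x
  have "smooth_map_on (g i) S" for i
    unfolding smooth_map_on_def g_def
    using C_diff_on_segment_integral[OF assms(2-4) D[of _ "axis i 1"], of _ 0] by simp
  moreover have "h x = h a + (\<Sum>i\<in>UNIV. (x $ i - a $ i) * g i x)" if x: "x \<in> S" for x
  proof -
    let ?d = "\<lambda>t. frechet_derivative h (at (a + t *\<^sub>R (x - a)))"
    have "((\<lambda>t. ?d t (x - a)) has_integral (h (a + 1 *\<^sub>R (x - a)) - h (a + 0 *\<^sub>R (x - a)))) {0..1}"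
    proof (rule fundamental_theorem_of_calculus)
      fix t :: real assume t: "t \<in> {0..1}"
      have inner: "((\<lambda>t. a + t *\<^sub>R (x - a)) has_derivative (\<lambda>s. s *\<^sub>R (x - a))) (at t within {0..1})"
        by (auto intro!: derivative_eq_intros)
      have "((\<lambda>t. h (a + t *\<^sub>R (x - a))) has_derivative (\<lambda>s. ?d t (s *\<^sub>R (x - a)))) (at t within {0..1})"
        by (rule has_derivative_compose[OF inner hd[OF seg[OF x t]]])
      then show "((\<lambda>t. h (a + t *\<^sub>R (x - a))) has_vector_derivative ?d t (x - a)) (at t within {0..1})"
        unfolding has_vector_derivative_def
        using linear_scale[OF bounded_linear.linear[OF has_derivative_bounded_linear[OF hd[OF seg[OF x t]]]]] by simp
    qed simp
    then have "h x - h a = integral {0..1} (\<lambda>t. ?d t (x - a))" by (simp add: integral_unique)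
    also have "\<dots> = integral {0..1} (\<lambda>t. \<Sum>i\<in>UNIV. (x $ i - a $ i) * ?d t (axis i 1))"
    proof (rule integral_cong)
      fix t :: real assume t: "t \<in> {0..1}"
      have lin: "linear (?d t)"
        by (rule bounded_linear.linear[OF has_derivative_bounded_linear[OF hd[OF seg[OF x t]]]])
      have "?d t (x - a) = ?d t (\<Sum>i\<in>UNIV. (x - a) $ i *s axis i 1)" by (simp only: basis_expansion)
      also have "\<dots> = (\<Sum>i\<in>UNIV. (x $ i - a $ i) * ?d t (axis i 1))"
        by (simp add: linear_sum[OF lin] linear_scale[OF lin] scalar_mult_eq_scaleR del: vector_minus_component) simp
      finally show "?d t (x - a) = (\<Sum>i\<in>UNIV. (x $ i - a $ i) * ?d t (axis i 1))" .
    qed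
    also have "\<dots> = (\<Sum>i\<in>UNIV. (x $ i - a $ i) * g i x)"
    proof -
      have "(\<lambda>t. ?d t (axis i 1)) integrable_on {0..1}" for i :: 'n
      proof (rule integrable_continuous_real)
        have "continuous_on S (\<lambda>x. frechet_derivative h (at x) (axis i 1))" using D[of 0] by simp
        then show "continuous_on {0..1} (\<lambda>t. ?d t (axis i 1))"
          by (rule continuous_on_compose2) (auto intro!: continuous_intros seg x)
      qed
      then show ?thesis unfolding g_def by (subst integral_sum) (auto intro!: integrable_on_mult_right)
    qed
    finally show ?thesis by simp
  qed
  moreover have "g i a = frechet_derivative h (at a) (axis i 1)" for i unfolding g_def by simp
  ultimately show thesis by (rule that)
qed

section \<open>Smooth functions on a manifold\<close>

locale smooth_manifold =
  fixes A :: "('a::{t2_space, second_countable_topology}, 'n::finite) chart set"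
  assumes atlas: "smooth_atlas A"
begin

lemma chart_exists: obtains U \<phi> where "(U, \<phi>) \<in> A" "p \<in> U"
proof -
  have "p \<in> (\<Union>c\<in>A. fst c)" using atlas unfolding smooth_atlas_def by blast
  then show thesis using that by force
qed

lemma chart_open: assumes "(U, \<phi>) \<in> A" shows "open U"
  using atlas assms unfolding smooth_atlas_def is_chart_def by blast

lemma chart_homeomorphism:
  assumes "(U, \<phi>) \<in> A"
  shows "homeomorphism U (\<phi> ` U) \<phi> (inv_into U \<phi>)" and "open (\<phi> ` U)"
  using atlas assms unfolding smooth_atlas_def is_chart_def by auto

lemma chart_inv [simp]: "(U, \<phi>) \<in> A \<Longrightarrow> q \<in> U \<Longrightarrow> inv_into U \<phi> (\<phi> q) = q"
  using chart_homeomorphism unfolding homeomorphism_def by blast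

lemma chart_image_open:
  assumes "(U, \<phi>) \<in> A" "open W"
  shows "open (\<phi> ` (U \<inter> W))"
proof -
  have "openin (top_of_set U) (U \<inter> W)" using assms(2) by auto
  from homeomorphism_imp_open_map[OF chart_homeomorphism(1)[OF assms(1)] this]
  show ?thesis using chart_homeomorphism(2)[OF assms(1)] openin_open_trans by blast
qed

lemma chart_transition:
  "(U, \<phi>) \<in> A \<Longrightarrow> (V, \<psi>) \<in> A \<Longrightarrow> smooth_map_on (\<psi> \<circ> inv_into U \<phi>) (\<phi> ` (U \<inter> V))"
  using atlas unfolding smooth_atlas_def smooth_transition_def by fastforce

lemma smooth_fun_on_open: "smooth_fun_on A W h \<Longrightarrow> open W"
  unfolding smooth_fun_on_def by blast

lemma smooth_fun_onD:
  "smooth_fun_on A W h \<Longrightarrow> (U, \<phi>) \<in> A \<Longrightarrow> smooth_map_on (h \<circ> inv_into U \<phi>) (\<phi> ` (U \<inter> W))"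
  unfolding smooth_fun_on_def by blast

lemma smooth_fun_onI:
  "open W \<Longrightarrow> (\<And>U \<phi>. (U, \<phi>) \<in> A \<Longrightarrow> smooth_map_on (h \<circ> inv_into U \<phi>) (\<phi> ` (U \<inter> W))) \<Longrightarrow>
    smooth_fun_on A W h"
  unfolding smooth_fun_on_def by blast

lemma smooth_fun_on_subset:
  assumes "smooth_fun_on A W h" "open V" "V \<subseteq> W"
  shows "smooth_fun_on A V h"
  by (rule smooth_fun_onI[OF assms(2)], rule smooth_map_on_subset[OF smooth_fun_onD[OF assms(1)]])
    (use assms(3) in auto)

lemma smooth_fun_on_cong:
  assumes "smooth_fun_on A W g" "\<And>q. q \<in> W \<Longrightarrow> g q = h q"
  shows "smooth_fun_on A W h"
proof (rule smooth_fun_onI)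
  show W: "open W" using assms(1) by (rule smooth_fun_on_open)
  fix U \<phi> assume c: "(U, \<phi>) \<in> A"
  show "smooth_map_on (h \<circ> inv_into U \<phi>) (\<phi> ` (U \<inter> W))"
    by (rule smooth_map_on_cong[OF chart_image_open[OF c W] _ smooth_fun_onD[OF assms(1) c]])
      (use c assms(2) in auto)
qed

lemma smooth_fun_on_local:
  assumes "open W" "\<And>p. p \<in> W \<Longrightarrow> smooth_near A p h"
  shows "smooth_fun_on A W h"
proof (rule smooth_fun_onI[OF assms(1)])
  fix U \<phi> assume c: "(U, \<phi>) \<in> A"
  show "smooth_map_on (h \<circ> inv_into U \<phi>) (\<phi> ` (U \<inter> W))"
    unfolding smooth_map_on_def
  proof (intro allI C_diff_on_local)
    fix k x assume "x \<in> \<phi> ` (U \<inter> W)"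
    then obtain q where q: "q \<in> U" "q \<in> W" "x = \<phi> q" by blast
    from assms(2)[OF q(2)] obtain V where V: "q \<in> V" "smooth_fun_on A V h"
      unfolding smooth_near_def by blast
    show "\<exists>T. open T \<and> x \<in> T \<and> C_diff_on k (h \<circ> inv_into U \<phi>) T"
      using chart_image_open[OF c smooth_fun_on_open[OF V(2)]] smooth_fun_onD[OF V(2) c] q V
      unfolding smooth_map_on_def by blast
  qed
qed

text \<open>
  On a chart domain smoothness need only be tested in that chart, as the transition maps are smooth.
\<close>

lemma smooth_fun_on_chartI:
  assumes c: "(U, \<phi>) \<in> A" and W: "open W" "W \<subseteq> U" and h: "smooth_map_on (h \<circ> inv_into U \<phi>) (\<phi> ` W)"
  shows "smooth_fun_on A W h"
proof (rule smooth_fun_onI[OF W(1)])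
  fix V \<psi> assume d: "(V, \<psi>) \<in> A"
  have eq: "U \<inter> W = W" using W(2) by blast
  have o: "open (\<psi> ` (V \<inter> W))" by (rule chart_image_open[OF d W(1)])
  have "smooth_map_on (\<lambda>x. (h \<circ> inv_into U \<phi>) ((\<phi> \<circ> inv_into V \<psi>) x)) (\<psi> ` (V \<inter> W))"
  proof (rule smooth_map_on_compose[OF o _ _ _ h])
    show "open (\<phi> ` W)" using chart_image_open[OF c W(1)] unfolding eq .
    show "smooth_map_on (\<phi> \<circ> inv_into V \<psi>) (\<psi> ` (V \<inter> W))"
      by (rule smooth_map_on_subset[OF chart_transition[OF d c]]) (use W(2) in auto)
  qed (use d in auto)
  then show "smooth_map_on (h \<circ> inv_into V \<psi>) (\<psi> ` (V \<inter> W))"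
    by (rule smooth_map_on_cong[OF o, rotated]) (use c d W(2) in auto)
qed

lemma smooth_fun_on_const: "open W \<Longrightarrow> smooth_fun_on A W (\<lambda>q. c)"
  by (rule smooth_fun_onI) (auto simp: smooth_map_on_def comp_def intro!: C_diff_on_const chart_image_open)

lemma smooth_fun_on_add:
  assumes "smooth_fun_on A W g" "smooth_fun_on A W h"
  shows "smooth_fun_on A W (\<lambda>q. g q + h q)"
  by (rule smooth_fun_onI[OF smooth_fun_on_open[OF assms(1)]])
    (use assms[THEN smooth_fun_onD] in
      \<open>auto simp: smooth_map_on_def comp_def intro!: C_diff_on_add chart_image_open smooth_fun_on_open[OF assms(1)]\<close>)

lemma smooth_fun_on_mult:
  assumes "smooth_fun_on A W g" "smooth_fun_on A W h"
  shows "smooth_fun_on A W (\<lambda>q. g q * h q)"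
  by (rule smooth_fun_onI[OF smooth_fun_on_open[OF assms(1)]])
    (use assms[THEN smooth_fun_onD] in
      \<open>auto simp: smooth_map_on_def comp_def intro!: C_diff_on_mult chart_image_open smooth_fun_on_open[OF assms(1)]\<close>)

lemma smooth_fun_on_diff:
  assumes "smooth_fun_on A W g" "smooth_fun_on A W h"
  shows "smooth_fun_on A W (\<lambda>q. g q - h q)"
  using smooth_fun_on_add[OF assms(1) smooth_fun_on_mult[OF smooth_fun_on_const[of W "-1"] assms(2)]]
    smooth_fun_on_open[OF assms(1)] by simp

lemma smooth_fun_on_divide:
  assumes "smooth_fun_on A W g" "smooth_fun_on A W h" "\<And>q. q \<in> W \<Longrightarrow> h q \<noteq> 0"
  shows "smooth_fun_on A W (\<lambda>q. g q / h q)"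
proof -
  have W: "open W" by (rule smooth_fun_on_open[OF assms(1)])
  have "smooth_fun_on A W (\<lambda>q. inverse (h q))"
  proof (rule smooth_fun_onI[OF W])
    fix U \<phi> assume c: "(U, \<phi>) \<in> A"
    show "smooth_map_on ((\<lambda>q. inverse (h q)) \<circ> inv_into U \<phi>) (\<phi> ` (U \<inter> W))"
      using smooth_fun_onD[OF assms(2) c] c assms(3)
      by (auto simp: smooth_map_on_def comp_def intro!: C_diff_on_inverse chart_image_open W)
  qed
  from smooth_fun_on_mult[OF assms(1) this] show ?thesis by (simp add: divide_inverse)
qed

lemma smooth_fun_on_sum:
  assumes "open W" "\<And>i. i \<in> I \<Longrightarrow> smooth_fun_on A W (g i)"
  shows "smooth_fun_on A W (\<lambda>q. \<Sum>i\<in>I. g i q)"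
  using assms(2)
  by (induction I rule: infinite_finite_induct)
    (auto intro: smooth_fun_on_add smooth_fun_on_const[OF assms(1)])

text \<open>
  Makes the domain of the first integral open.
\<close>

lemma smooth_fun_on_nonzero_open:
  assumes "smooth_fun_on A W h"
  shows "open {q \<in> W. h q \<noteq> 0}"
proof (subst open_subopen, intro ballI)
  fix p assume p: "p \<in> {q \<in> W. h q \<noteq> 0}"
  obtain U \<phi> where c: "(U, \<phi>) \<in> A" "p \<in> U" by (rule chart_exists)
  let ?V = "U \<inter> W"
  have V: "open ?V" using chart_open[OF c(1)] smooth_fun_on_open[OF assms] by blast
  have "C_diff_on 0 (h \<circ> inv_into U \<phi>) (\<phi> ` ?V)"
    using smooth_fun_onD[OF assms c(1)] unfolding smooth_map_on_def by (rule spec)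
  then have "continuous_on (\<phi> ` ?V) (h \<circ> inv_into U \<phi>)" by simp
  moreover have "continuous_on ?V \<phi>"
    by (rule continuous_on_subset[OF homeomorphism_cont1[OF chart_homeomorphism(1)[OF c(1)]]]) simp
  ultimately have "continuous_on ?V ((h \<circ> inv_into U \<phi>) \<circ> \<phi>)" by (rule continuous_on_compose[rotated])
  then have "continuous_on ?V h" by (rule continuous_on_eq) (use c in auto)
  then have "open (?V \<inter> h -` (- {0}))" by (rule continuous_open_preimage[OF _ V]) auto
  then show "\<exists>T. open T \<and> p \<in> T \<and> T \<subseteq> {q \<in> W. h q \<noteq> 0}"
    using p c by (intro exI[of _ "?V \<inter> h -` (- {0})"]) auto
qed

lemma smooth_nearI: "smooth_fun_on A W h \<Longrightarrow> p \<in> W \<Longrightarrow> smooth_near A p h"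
  unfolding smooth_near_def by blast

lemma smooth_nearE:
  assumes "smooth_near A p h" "open W" "p \<in> W"
  obtains V where "p \<in> V" "V \<subseteq> W" "smooth_fun_on A V h"
proof -
  from assms(1) obtain V where V: "p \<in> V" "smooth_fun_on A V h" unfolding smooth_near_def by blast
  show thesis
    by (rule that[of "V \<inter> W"])
      (use V assms in \<open>auto intro: smooth_fun_on_subset smooth_fun_on_open\<close>)
qed

lemma smooth_nearE2:
  assumes "smooth_near A p g" "smooth_near A p h" "open W" "p \<in> W"
  obtains V where "p \<in> V" "V \<subseteq> W" "smooth_fun_on A V g" "smooth_fun_on A V h"
proof -
  obtain V1 where 1: "p \<in> V1" "V1 \<subseteq> W" "smooth_fun_on A V1 g" using smooth_nearE[OF assms(1,3,4)] .
  obtain V2 where 2: "p \<in> V2" "V2 \<subseteq> V1" "smooth_fun_on A V2 h"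
    using smooth_nearE[OF assms(2) smooth_fun_on_open[OF 1(3)] 1(1)] .
  show thesis
    by (rule that[OF 2(1) _ _ 2(3)])
      (use 1 2 in \<open>auto intro: smooth_fun_on_subset smooth_fun_on_open\<close>)
qed

section \<open>Tangent vectors and vector fields\<close>

lemma tangent_outside: "v \<in> tangent_space A p \<Longrightarrow> \<not> smooth_near A p g \<Longrightarrow> v g = 0"
  unfolding tangent_space_def by blast

lemma tangent_linear:
  assumes "v \<in> tangent_space A p" "smooth_fun_on A W g" "smooth_fun_on A W h" "p \<in> W"
  shows "v (\<lambda>q. a * g q + b * h q) = a * v g + b * v h"
proof -
  have "\<forall>g h a b. smooth_near A p g \<and> smooth_near A p h \<longrightarrow> v (\<lambda>q. a * g q + b * h q) = a * v g + b * v h"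
    using assms(1) unfolding tangent_space_def mem_Collect_eq by (elim conjE)
  with assms(2-4) show ?thesis by (simp add: smooth_nearI)
qed

lemma tangent_mult:
  assumes "v \<in> tangent_space A p" "smooth_fun_on A W g" "smooth_fun_on A W h" "p \<in> W"
  shows "v (\<lambda>q. g q * h q) = g p * v h + h p * v g"
proof -
  have "\<forall>g h. smooth_near A p g \<and> smooth_near A p h \<longrightarrow> v (\<lambda>q. g q * h q) = g p * v h + h p * v g"
    using assms(1) unfolding tangent_space_def mem_Collect_eq by (elim conjE)
  with assms(2-4) show ?thesis by (simp add: smooth_nearI)
qed

lemma tangent_add:
  assumes "v \<in> tangent_space A p" "smooth_fun_on A W g" "smooth_fun_on A W h" "p \<in> W"
  shows "v (\<lambda>q. g q + h q) = v g + v h"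
  using tangent_linear[OF assms, of 1 1] by simp

lemma tangent_diff:
  assumes "v \<in> tangent_space A p" "smooth_fun_on A W g" "smooth_fun_on A W h" "p \<in> W"
  shows "v (\<lambda>q. g q - h q) = v g - v h"
  using tangent_linear[OF assms, of 1 "-1"] by simp

lemma tangent_const:
  assumes "v \<in> tangent_space A p"
  shows "v (\<lambda>q. c) = 0"
proof -
  have s: "smooth_fun_on A UNIV (\<lambda>q. c)" for c :: real by (rule smooth_fun_on_const) simp
  \<comment> \<open>the product rule for \<open>1 = 1 * 1\<close>\<close>
  have "v (\<lambda>q. 1) = 0" using tangent_mult[OF assms s[of 1] s[of 1]] by simp
  then show ?thesis using tangent_linear[OF assms s[of 1] s[of 1], of c 0] by simp
qed

lemma tangent_cong:
  assumes "v \<in> tangent_space A p" "smooth_fun_on A W g" "p \<in> W" "\<And>q. q \<in> W \<Longrightarrow> g q = h q"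
  shows "v g = v h"
proof -
  have "smooth_fun_on A W h" by (rule smooth_fun_on_cong[OF assms(2,4)])
  moreover have "eventually (\<lambda>q. g q = h q) (nhds p)"
    using assms(3,4) smooth_fun_on_open[OF assms(2)] unfolding eventually_nhds by blast
  moreover have "\<forall>g h. smooth_near A p g \<and> smooth_near A p h \<and> eventually (\<lambda>q. g q = h q) (nhds p)
      \<longrightarrow> v g = v h"
    using assms(1) unfolding tangent_space_def mem_Collect_eq by (elim conjE)
  ultimately show ?thesis
    using assms(2,3) by (simp add: smooth_nearI)
qed

lemma tangent_sum:
  assumes "v \<in> tangent_space A p" "p \<in> W" "open W" "\<And>i. i \<in> I \<Longrightarrow> smooth_fun_on A W (g i)"
  shows "v (\<lambda>q. \<Sum>i\<in>I. g i q) = (\<Sum>i\<in>I. v (g i))"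
  using assms(4)
proof (induction I rule: infinite_finite_induct)
  case (insert i I)
  have "v (\<lambda>q. g i q + (\<Sum>i\<in>I. g i q)) = v (g i) + v (\<lambda>q. \<Sum>i\<in>I. g i q)"
    by (rule tangent_add[OF assms(1) _ _ assms(2)]) (use insert assms(3) in \<open>auto intro: smooth_fun_on_sum\<close>)
  with insert show ?case by simp
qed (auto simp: tangent_const[OF assms(1)])

lemma tangent_divide:
  assumes "v \<in> tangent_space A p" "smooth_fun_on A W g" "smooth_fun_on A W h" "p \<in> W"
    and "\<And>q. q \<in> W \<Longrightarrow> h q \<noteq> 0"
  shows "v (\<lambda>q. g q / h q) = (h p * v g - g p * v h) / (h p * h p)"
proof -
  have s: "smooth_fun_on A W (\<lambda>q. g q / h q)" by (rule smooth_fun_on_divide[OF assms(2,3,5)])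
  \<comment> \<open>the product rule for \<open>g = (g / h) * h\<close>, solved for the derivative of the quotient\<close>
  have "v g = v (\<lambda>q. g q / h q * h q)"
    by (rule tangent_cong[OF assms(1,2,4)]) (use assms(5) in auto)
  also have "\<dots> = g p / h p * v h + h p * v (\<lambda>q. g q / h q)" by (rule tangent_mult[OF assms(1) s assms(3,4)])
  finally show ?thesis using assms(5)[OF assms(4)] by (simp add: field_simps)
qed

text \<open>
  Any two germs have representatives that are smooth on a common neighbourhood inside \<open>W\<close>, so the axioms
  of a derivation need only be verified for those.
\<close>

lemma tangent_spaceI:
  assumes "\<And>g. \<not> smooth_near A p g \<Longrightarrow> v g = 0" and "open W" "p \<in> W"
    and "\<And>V g h. p \<in> V \<Longrightarrow> V \<subseteq> W \<Longrightarrow> smooth_fun_on A V g \<Longrightarrow> smooth_fun_on A V h \<Longrightarrow>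
      (\<And>q. q \<in> V \<Longrightarrow> g q = h q) \<Longrightarrow> v g = v h"
    and "\<And>V g h a b. p \<in> V \<Longrightarrow> V \<subseteq> W \<Longrightarrow> smooth_fun_on A V g \<Longrightarrow> smooth_fun_on A V h \<Longrightarrow>
      v (\<lambda>q. a * g q + b * h q) = a * v g + b * v h"
    and "\<And>V g h. p \<in> V \<Longrightarrow> V \<subseteq> W \<Longrightarrow> smooth_fun_on A V g \<Longrightarrow> smooth_fun_on A V h \<Longrightarrow>
      v (\<lambda>q. g q * h q) = g p * v h + h p * v g"
  shows "v \<in> tangent_space A p"
proof -
  have cong: "v g = v h" if near: "smooth_near A p g" "smooth_near A p h" "eventually (\<lambda>q. g q = h q) (nhds p)" for g h
  proof -
    from near(3) obtain S where S: "open S" "p \<in> S" "\<And>q. q \<in> S \<Longrightarrow> g q = h q"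
      unfolding eventually_nhds by blast
    obtain V where "p \<in> V" "V \<subseteq> W \<inter> S" "smooth_fun_on A V g" "smooth_fun_on A V h"
      by (rule smooth_nearE2[OF near(1,2), of "W \<inter> S"]) (use S(1,2) assms(2,3) in auto)
    with assms(4)[of V g h] S(3) show ?thesis by blast
  qed
  have lin: "v (\<lambda>q. a * g q + b * h q) = a * v g + b * v h"
    if "smooth_near A p g" "smooth_near A p h" for g h a b
    using smooth_nearE2[OF that assms(2,3)] assms(5) by metis
  have mult: "v (\<lambda>q. g q * h q) = g p * v h + h p * v g"
    if "smooth_near A p g" "smooth_near A p h" for g h
    using smooth_nearE2[OF that assms(2,3)] assms(6) by metis
  show ?thesis
    unfolding tangent_space_def mem_Collect_eq
  proof (intro conjI allI impI; (elim conjE)?)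
    show "v g = 0" if "\<not> smooth_near A p g" for g by (rule assms(1)[OF that])
  qed (rule cong lin mult, assumption+)+
qed

lemma tangent_eqI:
  assumes "u \<in> tangent_space A p" "v \<in> tangent_space A p" "open W" "p \<in> W"
    and "\<And>V h. p \<in> V \<Longrightarrow> V \<subseteq> W \<Longrightarrow> smooth_fun_on A V h \<Longrightarrow> u h = v h"
  shows "u = v"
proof
  fix h
  show "u h = v h"
  proof (cases "smooth_near A p h")
    case True
    then show ?thesis using smooth_nearE[OF True assms(3,4)] assms(5) by metis
  qed (simp add: tangent_outside[OF assms(1)] tangent_outside[OF assms(2)])
qed

lemma tangent_space_lincomb:
  assumes "u \<in> tangent_space A p" "v \<in> tangent_space A p"
  shows "(\<lambda>h. a * u h + b * v h) \<in> tangent_space A p"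
proof (rule tangent_spaceI[of _ _ UNIV])
  show "a * u g + b * v g = a * u h + b * v h"
    if "p \<in> V" "smooth_fun_on A V g" "\<And>q. q \<in> V \<Longrightarrow> g q = h q" for V g h
    using tangent_cong[OF assms(1) that(2,1,3)] tangent_cong[OF assms(2) that(2,1,3)] by simp
qed (auto simp: tangent_outside[OF assms(1)] tangent_outside[OF assms(2)]
    tangent_linear[OF assms(1)] tangent_linear[OF assms(2)]
    tangent_mult[OF assms(1)] tangent_mult[OF assms(2)] algebra_simps)

lemma tangent_space_zero: "(\<lambda>h. 0) \<in> tangent_space A p"
  unfolding tangent_space_def by simp

lemma tangent_space_sum:
  assumes "\<And>i. i \<in> I \<Longrightarrow> u i \<in> tangent_space A p"
  shows "(\<lambda>h. \<Sum>i\<in>I. a i * u i h) \<in> tangent_space A p"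
  using assms
proof (induction I rule: infinite_finite_induct)
  case (insert i I)
  then show ?case
    using tangent_space_lincomb[of "u i" p "\<lambda>h. \<Sum>i\<in>I. a i * u i h" "a i" 1] by simp
qed (auto simp: tangent_space_zero)

lemma vfield_open: "smooth_vfield_on A W X \<Longrightarrow> open W"
  unfolding smooth_vfield_on_def by blast

lemma vfield_tangent: "smooth_vfield_on A W X \<Longrightarrow> p \<in> W \<Longrightarrow> X p \<in> tangent_space A p"
  unfolding smooth_vfield_on_def by blast

lemma vfield_smooth:
  "smooth_vfield_on A W X \<Longrightarrow> V \<subseteq> W \<Longrightarrow> smooth_fun_on A V h \<Longrightarrow> smooth_fun_on A V (\<lambda>q. X q h)"
  unfolding smooth_vfield_on_def by blast

lemma vfield_subset: "smooth_vfield_on A W X \<Longrightarrow> open V \<Longrightarrow> V \<subseteq> W \<Longrightarrow> smooth_vfield_on A V X"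
  unfolding smooth_vfield_on_def by blast

lemma vfield_sum:
  assumes "open W" "\<And>i. i \<in> I \<Longrightarrow> smooth_fun_on A W (a i)" "\<And>i. i \<in> I \<Longrightarrow> smooth_vfield_on A W (X i)"
  shows "smooth_vfield_on A W (\<lambda>p h. \<Sum>i\<in>I. a i p * X i p h)"
  unfolding smooth_vfield_on_def
proof (intro conjI ballI allI impI)
  show "(\<lambda>h. \<Sum>i\<in>I. a i p * X i p h) \<in> tangent_space A p" if "p \<in> W" for p
    by (rule tangent_space_sum) (rule vfield_tangent[OF assms(3) that])
  fix V h assume *: "V \<subseteq> W \<and> smooth_fun_on A V h"
  then have V: "open V" using smooth_fun_on_open by blast
  show "smooth_fun_on A V (\<lambda>p. \<Sum>i\<in>I. a i p * X i p h)"
    using * V by (intro smooth_fun_on_sum smooth_fun_on_mult)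
      (auto intro: vfield_smooth[OF assms(3)] smooth_fun_on_subset[OF assms(2)])
qed fact

lemma vfield_lincomb:
  assumes "smooth_fun_on A W a" "smooth_fun_on A W b" "smooth_vfield_on A W X" "smooth_vfield_on A W Y"
  shows "smooth_vfield_on A W (\<lambda>p h. a p * X p h + b p * Y p h)"
proof -
  \<comment> \<open>a sum of two terms as a sum over the truth values\<close>
  have "smooth_vfield_on A W (\<lambda>p h. \<Sum>i\<in>(UNIV::bool set). (if i then a else b) p * (if i then X else Y) p h)"
    by (rule vfield_sum) (use assms smooth_fun_on_open in auto)
  then show ?thesis by (simp add: UNIV_bool add.commute)
qed

lemma vfield_scale:
  assumes "smooth_fun_on A W a" "smooth_vfield_on A W X"
  shows "smooth_vfield_on A W (vf_scale a X)"
  using vfield_lincomb[OF assms(1) smooth_fun_on_const[of W 0] assms(2) assms(2)] vfield_open[OF assms(2)]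
  unfolding vf_scale_def by simp

lemma vfield_add:
  assumes "smooth_vfield_on A W X" "smooth_vfield_on A W Y"
  shows "smooth_vfield_on A W (vf_add X Y)"
  using vfield_lincomb[OF smooth_fun_on_const[of W 1] smooth_fun_on_const[of W 1] assms] vfield_open[OF assms(1)]
  unfolding vf_add_def by simp

lemma lie_bracket_apply:
  "smooth_fun_on A V h \<Longrightarrow> p \<in> V \<Longrightarrow>
    lie_bracket A X Y p h = X p (\<lambda>q. Y q h) - Y p (\<lambda>q. X q h)"
  unfolding lie_bracket_def lie_fun_def by (simp add: smooth_nearI)

lemma lie_bracket_tangent:
  assumes X: "smooth_vfield_on A W X" and Y: "smooth_vfield_on A W Y" and p: "p \<in> W"
  shows "lie_bracket A X Y p \<in> tangent_space A p"
proof (rule tangent_spaceI[OF _ vfield_open[OF X] p])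
  have Xp: "X p \<in> tangent_space A p" and Yp: "Y p \<in> tangent_space A p"
    using vfield_tangent X Y p by auto
  show "lie_bracket A X Y p g = 0" if "\<not> smooth_near A p g" for g
    using that unfolding lie_bracket_def by simp
  fix V g h a b
  assume V: "p \<in> V" "V \<subseteq> W" and g: "smooth_fun_on A V g" and h: "smooth_fun_on A V h"
  note sX = vfield_smooth[OF X V(2)] and sY = vfield_smooth[OF Y V(2)]
  note tX = vfield_tangent[OF X subsetD[OF V(2)]] and tY = vfield_tangent[OF Y subsetD[OF V(2)]]
  have o: "open V" using g by (rule smooth_fun_on_open)
  show "lie_bracket A X Y p g = lie_bracket A X Y p h" if eq: "\<And>q. q \<in> V \<Longrightarrow> g q = h q"
  proof -
    have "X p (\<lambda>q. Y q g) = X p (\<lambda>q. Y q h)"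
      by (rule tangent_cong[OF Xp sY[OF g] V(1)]) (rule tangent_cong[OF tY g _ eq])
    moreover have "Y p (\<lambda>q. X q g) = Y p (\<lambda>q. X q h)"
      by (rule tangent_cong[OF Yp sX[OF g] V(1)]) (rule tangent_cong[OF tX g _ eq])
    ultimately show ?thesis by (simp add: lie_bracket_apply[OF g V(1)] lie_bracket_apply[OF h V(1)])
  qed
  show "lie_bracket A X Y p (\<lambda>q. a * g q + b * h q) = a * lie_bracket A X Y p g + b * lie_bracket A X Y p h"
  proof -
    have s: "smooth_fun_on A V (\<lambda>q. a * g q + b * h q)"
      by (intro smooth_fun_on_add smooth_fun_on_mult smooth_fun_on_const o g h)
    have "X p (\<lambda>q. Y q (\<lambda>q. a * g q + b * h q)) = X p (\<lambda>q. a * Y q g + b * Y q h)"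
      by (rule tangent_cong[OF Xp sY[OF s] V(1)]) (rule tangent_linear[OF tY g h])
    moreover have "Y p (\<lambda>q. X q (\<lambda>q. a * g q + b * h q)) = Y p (\<lambda>q. a * X q g + b * X q h)"
      by (rule tangent_cong[OF Yp sX[OF s] V(1)]) (rule tangent_linear[OF tX g h])
    ultimately show ?thesis
      by (simp add: lie_bracket_apply[OF g V(1)] lie_bracket_apply[OF h V(1)] lie_bracket_apply[OF s V(1)]
          tangent_linear[OF Xp sY[OF g] sY[OF h] V(1)] tangent_linear[OF Yp sX[OF g] sX[OF h] V(1)]
          algebra_simps)
  qed
  show "lie_bracket A X Y p (\<lambda>q. g q * h q) = g p * lie_bracket A X Y p h + h p * lie_bracket A X Y p g"
  proof -
    have s: "smooth_fun_on A V (\<lambda>q. g q * h q)" by (rule smooth_fun_on_mult[OF g h])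
    have "X p (\<lambda>q. Y q (\<lambda>q. g q * h q)) = X p (\<lambda>q. g q * Y q h + h q * Y q g)"
      by (rule tangent_cong[OF Xp sY[OF s] V(1)]) (rule tangent_mult[OF tY g h])
    moreover have "Y p (\<lambda>q. X q (\<lambda>q. g q * h q)) = Y p (\<lambda>q. g q * X q h + h q * X q g)"
      by (rule tangent_cong[OF Yp sX[OF s] V(1)]) (rule tangent_mult[OF tX g h])
    ultimately show ?thesis
      by (simp add: lie_bracket_apply[OF g V(1)] lie_bracket_apply[OF h V(1)] lie_bracket_apply[OF s V(1)]
          tangent_add[OF Xp smooth_fun_on_mult[OF g sY[OF h]] smooth_fun_on_mult[OF h sY[OF g]] V(1)]
          tangent_add[OF Yp smooth_fun_on_mult[OF g sX[OF h]] smooth_fun_on_mult[OF h sX[OF g]] V(1)]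
          tangent_mult[OF Xp g sY[OF h] V(1)] tangent_mult[OF Xp h sY[OF g] V(1)]
          tangent_mult[OF Yp g sX[OF h] V(1)] tangent_mult[OF Yp h sX[OF g] V(1)]
          algebra_simps)
  qed
qed

lemma lie_bracket_smooth:
  assumes X: "smooth_vfield_on A W X" and Y: "smooth_vfield_on A W Y"
  shows "smooth_vfield_on A W (lie_bracket A X Y)"
  unfolding smooth_vfield_on_def
proof (intro conjI ballI allI impI)
  show "open W" by (rule vfield_open[OF X])
  show "lie_bracket A X Y p \<in> tangent_space A p" if "p \<in> W" for p by (rule lie_bracket_tangent[OF X Y that])
  fix V h assume *: "V \<subseteq> W \<and> smooth_fun_on A V h"
  then have V: "V \<subseteq> W" and h: "smooth_fun_on A V h" by auto
  have "smooth_fun_on A V (\<lambda>q. X q (\<lambda>r. Y r h) - Y q (\<lambda>r. X r h))"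
    by (intro smooth_fun_on_diff vfield_smooth[OF X V] vfield_smooth[OF Y V] h)
  then show "smooth_fun_on A V (\<lambda>q. lie_bracket A X Y q h)"
    by (rule smooth_fun_on_cong) (simp add: lie_bracket_apply[OF h])
qed

text \<open>
  As operators on functions, both sides are \<open>X Y Z - Y X Z - Z X Y + Z Y X\<close> once the brackets are expanded.
\<close>

lemma Jacobi_identity:
  assumes X: "smooth_vfield_on A W X" and Y: "smooth_vfield_on A W Y" and Z: "smooth_vfield_on A W Z"
    and p: "p \<in> W"
  shows "lie_bracket A (lie_bracket A X Y) Z p =
    (\<lambda>h. lie_bracket A X (lie_bracket A Y Z) p h - lie_bracket A Y (lie_bracket A X Z) p h)"
proof (rule tangent_eqI[OF _ _ vfield_open[OF X] p])
  note XY = lie_bracket_smooth[OF X Y] and YZ = lie_bracket_smooth[OF Y Z] and XZ = lie_bracket_smooth[OF X Z]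
  show "lie_bracket A (lie_bracket A X Y) Z p \<in> tangent_space A p"
    by (rule lie_bracket_tangent[OF XY Z p])
  show "(\<lambda>h. lie_bracket A X (lie_bracket A Y Z) p h - lie_bracket A Y (lie_bracket A X Z) p h) \<in> tangent_space A p"
    using tangent_space_lincomb[OF lie_bracket_tangent[OF X YZ p] lie_bracket_tangent[OF Y XZ p], of 1 "-1"]
    by simp
  fix V h assume V: "p \<in> V" "V \<subseteq> W" and h: "smooth_fun_on A V h"
  have second: "P p (\<lambda>q. lie_bracket A Q R q h) = P p (\<lambda>q. Q q (\<lambda>r. R r h)) - P p (\<lambda>q. R q (\<lambda>r. Q r h))"
    if P: "smooth_vfield_on A W P" and Q: "smooth_vfield_on A W Q" and R: "smooth_vfield_on A W R" for P Q R
  proof -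
    note tP = vfield_tangent[OF P p]
    note sQ = vfield_smooth[OF Q V(2)] and sR = vfield_smooth[OF R V(2)]
    have "P p (\<lambda>q. lie_bracket A Q R q h) = P p (\<lambda>q. Q q (\<lambda>r. R r h) - R q (\<lambda>r. Q r h))"
      by (rule tangent_cong[OF tP vfield_smooth[OF lie_bracket_smooth[OF Q R] V(2) h] V(1)])
        (rule lie_bracket_apply[OF h])
    also have "\<dots> = P p (\<lambda>q. Q q (\<lambda>r. R r h)) - P p (\<lambda>q. R q (\<lambda>r. Q r h))"
      by (rule tangent_diff[OF tP sQ[OF sR[OF h]] sR[OF sQ[OF h]] V(1)])
    finally show ?thesis .
  qed
  note app = lie_bracket_apply[OF _ V(1)]
  note sX = vfield_smooth[OF X V(2) h] and sY = vfield_smooth[OF Y V(2) h] and sZ = vfield_smooth[OF Z V(2) h]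
  show "lie_bracket A (lie_bracket A X Y) Z p h =
    lie_bracket A X (lie_bracket A Y Z) p h - lie_bracket A Y (lie_bracket A X Z) p h"
    by (simp add: app[OF h] app[OF sX] app[OF sY] app[OF sZ] second[OF X Y Z] second[OF Y X Z] second[OF Z X Y])
qed

end

section \<open>Coordinate frames\<close>

context smooth_manifold
begin

text \<open>
  The conditional is the normalization on non-smooth functions that membership in \<open>tangent_space\<close> demands.
\<close>

definition coord_field :: "'a set \<Rightarrow> ('a \<Rightarrow> real ^ 'n) \<Rightarrow> 'n \<Rightarrow> 'a vfield" where
  "coord_field U \<phi> i q h =
    (if smooth_near A q h then frechet_derivative (h \<circ> inv_into U \<phi>) (at (\<phi> q)) (axis i 1) else 0)"

lemma chart_has_derivative:
  assumes "(U, \<phi>) \<in> A" "q \<in> U" "smooth_fun_on A V h" "q \<in> V"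
  shows "(h \<circ> inv_into U \<phi> has_derivative frechet_derivative (h \<circ> inv_into U \<phi>) (at (\<phi> q))) (at (\<phi> q))"
  by (rule smooth_map_on_has_derivative[OF smooth_fun_onD[OF assms(3,1)]]) (use assms(2,4) in blast)

lemma coord_field_apply:
  "smooth_fun_on A V h \<Longrightarrow> q \<in> V \<Longrightarrow>
    coord_field U \<phi> i q h = frechet_derivative (h \<circ> inv_into U \<phi>) (at (\<phi> q)) (axis i 1)"
  unfolding coord_field_def by (simp add: smooth_nearI)

lemma coord_field_smooth:
  assumes c: "(U, \<phi>) \<in> A"
  shows "smooth_vfield_on A U (coord_field U \<phi> i)"
  unfolding smooth_vfield_on_def
proof (intro conjI ballI allI impI)
  show U: "open U" by (rule chart_open[OF c])
  show "coord_field U \<phi> i q \<in> tangent_space A q" if q: "q \<in> U" for q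
  proof (rule tangent_spaceI[OF _ U q])
    show "coord_field U \<phi> i q g = 0" if "\<not> smooth_near A q g" for g
      using that unfolding coord_field_def by simp
    fix V g h a b
    assume V: "q \<in> V" "V \<subseteq> U" and g: "smooth_fun_on A V g" and h: "smooth_fun_on A V h"
    let ?g = "g \<circ> inv_into U \<phi>" and ?h = "h \<circ> inv_into U \<phi>"
    note dg = chart_has_derivative[OF c q g V(1)] and dh = chart_has_derivative[OF c q h V(1)]
    have o: "open V" using g by (rule smooth_fun_on_open)
    show "coord_field U \<phi> i q g = coord_field U \<phi> i q h" if eq: "\<And>q. q \<in> V \<Longrightarrow> g q = h q"
    proof -
      have "frechet_derivative ?g (at (\<phi> q)) = frechet_derivative ?h (at (\<phi> q))"
      proof (rule frechet_derivative_transform_within_open[OF _ chart_image_open[OF c o]])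
        show "?g differentiable at (\<phi> q)" using dg unfolding differentiable_def by blast
        show "\<phi> q \<in> \<phi> ` (U \<inter> V)" using q V(1) by blast
        show "?g x = ?h x" if "x \<in> \<phi> ` (U \<inter> V)" for x using that c eq by auto
      qed
      then show ?thesis by (simp add: coord_field_apply[OF g V(1)] coord_field_apply[OF h V(1)])
    qed
    show "coord_field U \<phi> i q (\<lambda>q. a * g q + b * h q) = a * coord_field U \<phi> i q g + b * coord_field U \<phi> i q h"
    proof -
      have s: "smooth_fun_on A V (\<lambda>q. a * g q + b * h q)"
        by (intro smooth_fun_on_add smooth_fun_on_mult smooth_fun_on_const o g h)
      have "((\<lambda>q. a * g q + b * h q) \<circ> inv_into U \<phi> has_derivative
          (\<lambda>d. a * frechet_derivative ?g (at (\<phi> q)) d + b * frechet_derivative ?h (at (\<phi> q)) d)) (at (\<phi> q))"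
        using has_derivative_add[OF has_derivative_mult_right[OF dg, of a] has_derivative_mult_right[OF dh, of b]]
        by (simp add: comp_def)
      from fun_cong[OF frechet_derivative_at[OF this, symmetric], of "axis i 1"] show ?thesis
        by (simp add: coord_field_apply[OF g V(1)] coord_field_apply[OF h V(1)] coord_field_apply[OF s V(1)])
    qed
    show "coord_field U \<phi> i q (\<lambda>q. g q * h q) = g q * coord_field U \<phi> i q h + h q * coord_field U \<phi> i q g"
    proof -
      have s: "smooth_fun_on A V (\<lambda>q. g q * h q)" by (rule smooth_fun_on_mult[OF g h])
      have "((\<lambda>q. g q * h q) \<circ> inv_into U \<phi> has_derivative
          (\<lambda>d. ?g (\<phi> q) * frechet_derivative ?h (at (\<phi> q)) d + frechet_derivative ?g (at (\<phi> q)) d * ?h (\<phi> q))) (at (\<phi> q))"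
        using has_derivative_mult[OF dg dh] by (simp add: comp_def)
      from fun_cong[OF frechet_derivative_at[OF this, symmetric], of "axis i 1"] show ?thesis
        using c q by (simp add: coord_field_apply[OF g V(1)] coord_field_apply[OF h V(1)] coord_field_apply[OF s V(1)])
    qed
  qed
  fix V h assume *: "V \<subseteq> U \<and> smooth_fun_on A V h"
  then have V: "V \<subseteq> U" and h: "smooth_fun_on A V h" by auto
  have o: "open V" using h by (rule smooth_fun_on_open)
  have eq: "U \<inter> V = V" using V by blast
  show "smooth_fun_on A V (\<lambda>q. coord_field U \<phi> i q h)"
  proof (rule smooth_fun_on_chartI[OF c o V])
    have o': "open (\<phi> ` V)" using chart_image_open[OF c o] unfolding eq .
    have "smooth_map_on (h \<circ> inv_into U \<phi>) (\<phi> ` V)" using smooth_fun_onD[OF h c] unfolding eq .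
    from smooth_map_on_derivative[OF this]
    show "smooth_map_on ((\<lambda>q. coord_field U \<phi> i q h) \<circ> inv_into U \<phi>) (\<phi> ` V)"
      by (rule smooth_map_on_cong[OF o', rotated]) (use V c in \<open>auto simp: coord_field_apply[OF h] subsetD\<close>)
  qed
qed

lemma coord_smooth:
  assumes c: "(U, \<phi>) \<in> A"
  shows "smooth_fun_on A U (\<lambda>q. \<phi> q $ i)"
proof (rule smooth_fun_on_chartI[OF c chart_open[OF c] subset_refl])
  have o: "open (\<phi> ` U)" by (rule chart_homeomorphism(2)[OF c])
  have "smooth_map_on (\<lambda>x. x $ i) (\<phi> ` U)"
    unfolding smooth_map_on_def
    by (intro allI C_diff_on_bounded_linear_compose[OF o bounded_linear_vec_nth] C_diff_on_ident o)
  then show "smooth_map_on ((\<lambda>q. \<phi> q $ i) \<circ> inv_into U \<phi>) (\<phi> ` U)"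
    by (rule smooth_map_on_cong[OF o, rotated]) (use c in auto)
qed

text \<open>
  Apply the derivation \<open>v\<close> to Hadamard's expansion \<open>h = h(q) + \<Sum>\<^sub>i (\<phi>\<^sub>i - \<phi>\<^sub>i(q)) g\<^sub>i\<close> around \<open>q\<close>: constants are
  annihilated, and since the factors \<open>\<phi>\<^sub>i - \<phi>\<^sub>i(q)\<close> vanish at \<open>q\<close>, the product rule leaves only
  \<open>\<Sum>\<^sub>i g\<^sub>i(q) v(\<phi>\<^sub>i)\<close>, where \<open>g\<^sub>i(q)\<close> is the \<open>i\<close>-th partial derivative of \<open>h\<close>.
\<close>

lemma tangent_coord_expansion:
  assumes c: "(U, \<phi>) \<in> A" and q: "q \<in> U" and v: "v \<in> tangent_space A q"
  shows "v = (\<lambda>h. \<Sum>i\<in>UNIV. v (\<lambda>r. \<phi> r $ i) * coord_field U \<phi> i q h)"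
proof (rule tangent_eqI[OF v _ chart_open[OF c] q])
  show "(\<lambda>h. \<Sum>i\<in>UNIV. v (\<lambda>r. \<phi> r $ i) * coord_field U \<phi> i q h) \<in> tangent_space A q"
    by (intro tangent_space_sum vfield_tangent[OF coord_field_smooth[OF c] q])
  fix V h assume V: "q \<in> V" "V \<subseteq> U" and h: "smooth_fun_on A V h"
  have o: "open V" using h by (rule smooth_fun_on_open)
  have eq: "U \<inter> V = V" using V by blast
  have sm: "smooth_map_on (h \<circ> inv_into U \<phi>) (\<phi> ` V)" using smooth_fun_onD[OF h c] unfolding eq .
  have "open (\<phi> ` V)" using chart_image_open[OF c o] unfolding eq .
  then obtain r where r: "r > 0" "ball (\<phi> q) r \<subseteq> \<phi> ` V"
    using V(1) unfolding open_contains_ball by blast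
  let ?B = "ball (\<phi> q) r"
  obtain g where g: "\<And>i. smooth_map_on (g i) ?B"
    and gsum: "\<And>x. x \<in> ?B \<Longrightarrow> (h \<circ> inv_into U \<phi>) x =
      (h \<circ> inv_into U \<phi>) (\<phi> q) + (\<Sum>i\<in>UNIV. (x $ i - \<phi> q $ i) * g i x)"
    and gq: "\<And>i. g i (\<phi> q) = frechet_derivative (h \<circ> inv_into U \<phi>) (at (\<phi> q)) (axis i 1)"
    using smooth_map_Hadamard[OF smooth_map_on_subset[OF sm r(2)], of "\<phi> q"] r(1) by auto
  \<comment> \<open>the part of the manifold on which Hadamard's expansion holds\<close>
  define W where "W = U \<inter> \<phi> -` ?B"
  have W: "open W" unfolding W_def
    by (rule continuous_open_preimage[OF homeomorphism_cont1[OF chart_homeomorphism(1)[OF c]] chart_open[OF c]]) simp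
  have qW: "q \<in> W" using q r(1) unfolding W_def by simp
  have WV: "W \<subseteq> V"
  proof
    fix s assume s: "s \<in> W"
    then obtain t where "t \<in> V" "\<phi> s = \<phi> t" using r(2) unfolding W_def by blast
    then show "s \<in> V" using chart_inv[OF c, of s] chart_inv[OF c, of t] s V(2) unfolding W_def by auto
  qed
  have WU: "W \<subseteq> U" unfolding W_def by blast
  have sg: "smooth_fun_on A W (\<lambda>s. g i (\<phi> s))" for i
  proof (rule smooth_fun_on_chartI[OF c W WU])
    have "U \<inter> W = W" using WU by blast
    then have o': "open (\<phi> ` W)" using chart_image_open[OF c W] by simp
    have "smooth_map_on (g i) (\<phi> ` W)"
      by (rule smooth_map_on_subset[OF g]) (auto simp: W_def)
    then show "smooth_map_on ((\<lambda>s. g i (\<phi> s)) \<circ> inv_into U \<phi>) (\<phi> ` W)"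
      by (rule smooth_map_on_cong[OF o', rotated]) (use c WU in \<open>auto simp: subsetD\<close>)
  qed
  have sx: "smooth_fun_on A W (\<lambda>s. \<phi> s $ i - \<phi> q $ i)" for i
    by (intro smooth_fun_on_diff smooth_fun_on_const W smooth_fun_on_subset[OF coord_smooth[OF c] W WU])
  have vx: "v (\<lambda>s. \<phi> s $ i - \<phi> q $ i) = v (\<lambda>s. \<phi> s $ i)" for i
    using tangent_diff[OF v smooth_fun_on_subset[OF coord_smooth[OF c] W WU] smooth_fun_on_const[OF W] qW]
    by (simp add: tangent_const[OF v])
  have "v h = v (\<lambda>s. h q + (\<Sum>i\<in>UNIV. (\<phi> s $ i - \<phi> q $ i) * g i (\<phi> s)))"
  proof (rule tangent_cong[OF v smooth_fun_on_subset[OF h W WV] qW])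
    fix s assume s: "s \<in> W"
    then have "s \<in> U" "\<phi> s \<in> ?B" unfolding W_def by auto
    then show "h s = h q + (\<Sum>i\<in>UNIV. (\<phi> s $ i - \<phi> q $ i) * g i (\<phi> s))"
      using gsum[of "\<phi> s"] chart_inv[OF c] q by simp
  qed
  also have "\<dots> = v (\<lambda>s. \<Sum>i\<in>UNIV. (\<phi> s $ i - \<phi> q $ i) * g i (\<phi> s))"
    by (subst tangent_add[OF v smooth_fun_on_const[OF W] _ qW])
      (auto simp: tangent_const[OF v] intro!: smooth_fun_on_sum smooth_fun_on_mult W sx sg)
  also have "\<dots> = (\<Sum>i\<in>UNIV. v (\<lambda>s. (\<phi> s $ i - \<phi> q $ i) * g i (\<phi> s)))"
    by (rule tangent_sum[OF v qW W smooth_fun_on_mult[OF sx sg]])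
  also have "\<dots> = (\<Sum>i\<in>UNIV. v (\<lambda>s. \<phi> s $ i) * coord_field U \<phi> i q h)"
    by (simp add: tangent_mult[OF v sx sg qW] vx gq coord_field_apply[OF h V(1)]) (simp add: mult.commute)
  finally show "v h = (\<Sum>i\<in>UNIV. v (\<lambda>s. \<phi> s $ i) * coord_field U \<phi> i q h)" .
qed

text \<open>
  A frame comes with coordinate functions \<open>x\<close> that give the coefficients of tangent vectors. As the \<open>x i\<close> are
  smooth, so are the coefficients \<open>Z q (x i)\<close> of a smooth field \<open>Z\<close>.
\<close>

definition frame_on :: "'a set \<Rightarrow> ('n \<Rightarrow> 'a vfield) \<Rightarrow> ('n \<Rightarrow> 'a \<Rightarrow> real) \<Rightarrow> bool" where
  "frame_on W E x \<longleftrightarrow> (\<forall>i. smooth_vfield_on A W (E i)) \<and> (\<forall>i. smooth_fun_on A W (x i)) \<and>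
    (\<forall>q\<in>W. \<forall>v\<in>tangent_space A q. v = (\<lambda>h. \<Sum>i\<in>UNIV. v (x i) * E i q h))"

lemma frame_vfield: "frame_on W E x \<Longrightarrow> smooth_vfield_on A W (E i)"
  unfolding frame_on_def by blast

lemma frame_coord: "frame_on W E x \<Longrightarrow> smooth_fun_on A W (x i)"
  unfolding frame_on_def by blast

lemma frame_expansion:
  "frame_on W E x \<Longrightarrow> q \<in> W \<Longrightarrow> v \<in> tangent_space A q \<Longrightarrow> v = (\<lambda>h. \<Sum>i\<in>UNIV. v (x i) * E i q h)"
  unfolding frame_on_def by blast

lemma frame_subset:
  assumes "frame_on W E x" "open V" "V \<subseteq> W"
  shows "frame_on V E x"
  unfolding frame_on_def
  using assms(3) vfield_subset[OF frame_vfield[OF assms(1)] assms(2,3)]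
    smooth_fun_on_subset[OF frame_coord[OF assms(1)] assms(2,3)] frame_expansion[OF assms(1)] by auto

lemma local_frame: obtains U E x where "p \<in> U" "frame_on U E x"
proof -
  obtain U \<phi> where c: "(U, \<phi>) \<in> A" "p \<in> U" by (rule chart_exists)
  have "frame_on U (coord_field U \<phi>) (\<lambda>i q. \<phi> q $ i)"
    unfolding frame_on_def
    using coord_field_smooth[OF c(1)] coord_smooth[OF c(1)] tangent_coord_expansion[OF c(1)] by blast
  with c(2) show thesis by (rule that)
qed

end

section \<open>Alternating forms on the span of a basis\<close>

lemma alternating_linear:
  assumes "alternating_multilinear T w" "range v \<subseteq> T" "x \<in> T" "y \<in> T"
  shows "w (v(i := (\<lambda>h. a * x h + b * y h))) = a * w (v(i := x)) + b * w (v(i := y))"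
  using assms unfolding alternating_multilinear_def by blast

lemma alternating_repeat:
  "alternating_multilinear T w \<Longrightarrow> range v \<subseteq> T \<Longrightarrow> i \<noteq> j \<Longrightarrow> v i = v j \<Longrightarrow> w v = 0"
  unfolding alternating_multilinear_def by blast

lemma alternating_zero:
  assumes "alternating_multilinear T w" "range v \<subseteq> T" "x \<in> T"
  shows "w (v(i := (\<lambda>h. 0))) = 0"
  using alternating_linear[OF assms(1,2,3,3), of i 0 0] by simp

lemma alternating_sum:
  assumes "alternating_multilinear T w" "range v \<subseteq> T" "finite J" "\<And>j. j \<in> J \<Longrightarrow> u j \<in> T"
    and T0: "(\<lambda>h. 0) \<in> T" and T: "\<And>x y a b. x \<in> T \<Longrightarrow> y \<in> T \<Longrightarrow> (\<lambda>h. a * x h + b * y h) \<in> T"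
  shows "w (v(i := (\<lambda>h. \<Sum>j\<in>J. a j * u j h))) = (\<Sum>j\<in>J. a j * w (v(i := u j)))"
proof -
  have "w (v(i := (\<lambda>h. \<Sum>j\<in>J. a j * u j h))) = (\<Sum>j\<in>J. a j * w (v(i := u j)))
      \<and> (\<lambda>h. \<Sum>j\<in>J. a j * u j h) \<in> T"
    using assms(3,4)
  proof (induction J rule: finite_induct)
    case empty
    then show ?case using alternating_zero[OF assms(1,2) T0] T0 by (simp only: sum.empty)
  next
    case (insert j J)
    then have u: "u j \<in> T" and s: "(\<lambda>h. \<Sum>j\<in>J. a j * u j h) \<in> T" by auto
    show ?case
      using alternating_linear[OF assms(1,2) u s, of i "a j" 1] T[OF u s, of "a j" 1] insert by (simp del: fun_upd_apply)
  qed
  then show ?thesis ..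
qed

text \<open>
  Polarization: expand the vanishing value with \<open>v i + v j\<close> in both slots.
\<close>

lemma alternating_swap:
  assumes w: "alternating_multilinear T w" and v: "range v \<subseteq> T" and ij: "i \<noteq> j"
    and T: "\<And>x y a b. x \<in> T \<Longrightarrow> y \<in> T \<Longrightarrow> (\<lambda>h. a * x h + b * y h) \<in> T"
  shows "w (v(i := v j, j := v i)) = - w v"
proof -
  let ?s = "\<lambda>h. 1 * v i h + 1 * v j h"
  have m: "v i \<in> T" "v j \<in> T" using v by auto
  have s: "?s \<in> T" by (rule T[OF m])
  have rep: "w (v(i := x, j := x)) = 0" if "x \<in> T" for x
    by (rule alternating_repeat[OF w _ ij]) (use v that ij in auto)
  have exp_j: "w (v(i := x, j := ?s)) = w (v(i := x, j := v i)) + w (v(i := x, j := v j))" if "x \<in> T" for x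
    using alternating_linear[OF w _ m, of "v(i := x)" j 1 1] v that by auto
  have exp_i: "w (v(i := ?s, j := x)) = w (v(i := v i, j := x)) + w (v(i := v j, j := x))" if "x \<in> T" for x
  proof -
    have twist: "v(i := y, j := x) = v(j := x, i := y)" for y using ij by (rule fun_upd_twist)
    have "range (v(j := x)) \<subseteq> T" using v that by auto
    from alternating_linear[OF w this m, of i 1 1] show ?thesis unfolding twist by simp
  qed
  have "0 = w (v(i := ?s, j := ?s))" using rep[OF s] by simp
  also have "\<dots> = w (v(i := v i, j := v i)) + w (v(i := v j, j := v i)) + (w (v(i := v i, j := v j)) + w (v(i := v j, j := v j)))"
    unfolding exp_j[OF s] exp_i[OF m(1)] exp_i[OF m(2)] by simp
  also have "\<dots> = w (v(i := v j, j := v i)) + w v" using rep[OF m(1)] rep[OF m(2)] by simp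
  finally show ?thesis by simp
qed

text \<open>
  Expanding all arguments in the basis reduces the claim to families \<open>e \<circ> \<sigma>\<close>. If \<open>\<sigma>\<close> is not injective, an
  argument is repeated; otherwise \<open>\<sigma>\<close> is a permutation and transpositions lead back to \<open>e\<close>.
\<close>

lemma alternating_eq_zero_if_zero_on_basis:
  fixes w :: "('n::finite \<Rightarrow> 'a tvec) \<Rightarrow> real"
  assumes w: "alternating_multilinear T w" and e: "range e \<subseteq> T" and we: "w e = 0"
    and T0: "(\<lambda>h. 0) \<in> T" and T: "\<And>x y a b. x \<in> T \<Longrightarrow> y \<in> T \<Longrightarrow> (\<lambda>h. a * x h + b * y h) \<in> T"
    and span: "\<And>x. x \<in> T \<Longrightarrow> \<exists>a. x = (\<lambda>h. \<Sum>j\<in>UNIV. a j * e j h)"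
    and v: "range v \<subseteq> T"
  shows "w v = 0"
proof -
  have perm: "w (e \<circ> \<sigma>) = 0" if "\<sigma> permutes UNIV" for \<sigma> :: "'n \<Rightarrow> 'n"
    using finite[of "UNIV :: 'n set"] that
  proof (induction \<sigma> rule: permutes_rev_induct)
    case id
    then show ?case using we by simp
  next
    case (swap a b p)
    have "w ((e \<circ> p)(a := (e \<circ> p) b, b := (e \<circ> p) a)) = - w (e \<circ> p)"
      by (rule alternating_swap[OF w _ swap(3) T]) (use e in auto)
    moreover have "(e \<circ> p)(a := (e \<circ> p) b, b := (e \<circ> p) a) = e \<circ> (p \<circ> Transposition.transpose a b)"
      by (auto simp: fun_eq_iff Transposition.transpose_def)
    ultimately show ?case using swap(5) by (simp only: minus_zero)
  qed
  have basis: "w (e \<circ> \<sigma>) = 0" for \<sigma> :: "'n \<Rightarrow> 'n"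
  proof (cases "inj \<sigma>")
    case True
    then have "\<sigma> permutes UNIV"
      using finite_UNIV_inj_surj[OF finite True] by (intro bij_imp_permutes) (auto simp: bij_def)
    then show ?thesis by (rule perm)
  next
    case False
    then obtain i j where "i \<noteq> j" "\<sigma> i = \<sigma> j" unfolding inj_def by blast
    then show ?thesis by (intro alternating_repeat[OF w, of _ i j]) (use e in auto)
  qed
  \<comment> \<open>\<open>I\<close> contains the slots that have not yet been filled with basis vectors\<close>
  have "w v = 0" if "finite I" "\<forall>i. i \<notin> I \<longrightarrow> v i \<in> range e" "range v \<subseteq> T" for I v
    using that
  proof (induction I arbitrary: v rule: finite_induct)
    case empty
    then have "\<forall>i. \<exists>j. v i = e j" by blast
    then obtain \<sigma> where "\<forall>i. v i = e (\<sigma> i)" by metis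
    then have "v = e \<circ> \<sigma>" by auto
    then show ?case by (simp only: basis)
  next
    case (insert k I)
    have "v k \<in> T" using insert.prems by blast
    then obtain a where a: "v k = (\<lambda>h. \<Sum>j\<in>UNIV. a j * e j h)" using span by blast
    have z: "w (v(k := e j)) = 0" for j
      by (rule insert.IH) (use insert.prems e in auto)
    have "w v = w (v(k := (\<lambda>h. \<Sum>j\<in>UNIV. a j * e j h)))" using a by (metis fun_upd_triv)
    also have "\<dots> = (\<Sum>j\<in>UNIV. a j * w (v(k := e j)))"
      by (rule alternating_sum[OF w insert.prems(2) finite _ T0 T]) (use e in auto)
    also have "\<dots> = 0" by (simp only: z mult_zero_right sum.neutral_const)
    finally show ?case .
  qed
  from this[of UNIV v] v show ?thesis by simp
qed

section \<open>The Lie derivative of a form\<close>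

context smooth_manifold
begin

lemma lie_bracket_cong:
  assumes X: "smooth_vfield_on A W X" and Y: "smooth_vfield_on A W Y" and p: "p \<in> W"
    and eq: "\<And>q. q \<in> W \<Longrightarrow> Y q = Z q"
  shows "lie_bracket A X Y p = lie_bracket A X Z p"
proof
  fix h
  show "lie_bracket A X Y p h = lie_bracket A X Z p h"
  proof (cases "smooth_near A p h")
    case True
    then obtain V where V: "p \<in> V" "V \<subseteq> W" "smooth_fun_on A V h"
      using smooth_nearE[OF True vfield_open[OF X] p] by metis
    have "X p (\<lambda>q. Y q h) = X p (\<lambda>q. Z q h)"
      by (rule tangent_cong[OF vfield_tangent[OF X p] vfield_smooth[OF Y V(2,3)] V(1)])
        (use eq V(2) in auto)
    then show ?thesis using eq[OF p] by (simp add: lie_bracket_apply[OF V(3,1)])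
  qed (simp add: lie_bracket_def)
qed

text \<open>
  The product rule of the bracket. The second sum is what has to cancel in order that the Lie derivative
  of a form is tensorial.
\<close>

lemma lie_bracket_sum:
  assumes X: "smooth_vfield_on A W X" and Y: "\<And>j. j \<in> J \<Longrightarrow> smooth_vfield_on A W (Y j)"
    and a: "\<And>j. j \<in> J \<Longrightarrow> smooth_fun_on A W (a j)" and p: "p \<in> W"
  shows "lie_bracket A X (\<lambda>q h. \<Sum>j\<in>J. a j q * Y j q h) p =
    (\<lambda>h. (\<Sum>j\<in>J. a j p * lie_bracket A X (Y j) p h) + (\<Sum>j\<in>J. X p (a j) * Y j p h))"
proof -
  note W = vfield_open[OF X]
  have S: "smooth_vfield_on A W (\<lambda>q h. \<Sum>j\<in>J. a j q * Y j q h)"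
    by (rule vfield_sum[OF W a Y])
  show ?thesis
  proof (rule tangent_eqI[OF lie_bracket_tangent[OF X S p] _ W p])
    show "(\<lambda>h. (\<Sum>j\<in>J. a j p * lie_bracket A X (Y j) p h) + (\<Sum>j\<in>J. X p (a j) * Y j p h)) \<in> tangent_space A p"
      using tangent_space_lincomb[OF tangent_space_sum[of J "\<lambda>j. lie_bracket A X (Y j) p" p "\<lambda>j. a j p"]
          tangent_space_sum[of J "\<lambda>j. Y j p" p "\<lambda>j. X p (a j)"], of 1 1]
        lie_bracket_tangent[OF X Y p] vfield_tangent[OF Y p] by simp
    fix V h assume V: "p \<in> V" "V \<subseteq> W" and h: "smooth_fun_on A V h"
    have o: "open V" using h by (rule smooth_fun_on_open)
    note Xp = vfield_tangent[OF X p]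
    have Sp: "(\<lambda>h. \<Sum>j\<in>J. a j p * Y j p h) \<in> tangent_space A p"
      by (rule tangent_space_sum) (rule vfield_tangent[OF Y p])
    have sa: "smooth_fun_on A V (a j)" if "j \<in> J" for j by (rule smooth_fun_on_subset[OF a[OF that] o V(2)])
    have sY: "smooth_fun_on A V (\<lambda>q. Y j q h)" if "j \<in> J" for j by (rule vfield_smooth[OF Y[OF that] V(2) h])
    have "X p (\<lambda>q. \<Sum>j\<in>J. a j q * Y j q h) = (\<Sum>j\<in>J. X p (\<lambda>q. a j q * Y j q h))"
      by (rule tangent_sum[OF Xp V(1) o]) (intro smooth_fun_on_mult sa sY)
    also have "\<dots> = (\<Sum>j\<in>J. a j p * X p (\<lambda>q. Y j q h) + Y j p h * X p (a j))"
      by (intro sum.cong refl tangent_mult[OF Xp sa sY V(1)])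
    finally have "X p (\<lambda>q. \<Sum>j\<in>J. a j q * Y j q h) =
      (\<Sum>j\<in>J. a j p * X p (\<lambda>q. Y j q h)) + (\<Sum>j\<in>J. X p (a j) * Y j p h)"
      by (simp add: sum.distrib mult.commute)
    then show "lie_bracket A X (\<lambda>q h. \<Sum>j\<in>J. a j q * Y j q h) p h =
      (\<Sum>j\<in>J. a j p * lie_bracket A X (Y j) p h) + (\<Sum>j\<in>J. X p (a j) * Y j p h)"
      by (simp add: lie_bracket_apply[OF h V(1)] right_diff_distrib sum_subtractf)
  qed
qed

lemma form_alternating: "smooth_form A \<omega> \<Longrightarrow> alternating_multilinear (tangent_space A p) (\<omega> p)"
  unfolding smooth_form_def by blast

lemma form_smooth:
  "smooth_form A \<omega> \<Longrightarrow> open W \<Longrightarrow> (\<And>i. smooth_vfield_on A W (Y i)) \<Longrightarrow>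
    smooth_fun_on A W (\<lambda>p. \<omega> p (\<lambda>i. Y i p))"
  unfolding smooth_form_def by blast

lemma form_sum:
  assumes "smooth_form A \<omega>" "range v \<subseteq> tangent_space A p" "finite J" "\<And>j. j \<in> J \<Longrightarrow> u j \<in> tangent_space A p"
  shows "\<omega> p (v(i := (\<lambda>h. \<Sum>j\<in>J. a j * u j h))) = (\<Sum>j\<in>J. a j * \<omega> p (v(i := u j)))"
  by (rule alternating_sum[OF form_alternating[OF assms(1)] assms(2-4) tangent_space_zero tangent_space_lincomb])

text \<open>
  The value that \<open>lie_form\<close> should have at \<open>p\<close> according to one particular choice \<open>Y\<close> of fields extending
  the arguments.
\<close>

definition lie_form_along :: "'a vfield \<Rightarrow> ('a, 'k::finite) form \<Rightarrow> ('k \<Rightarrow> 'a vfield) \<Rightarrow> 'a \<Rightarrow> real" where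
  "lie_form_along X \<omega> Y p = X p (\<lambda>q. \<omega> q (\<lambda>i. Y i q))
     - (\<Sum>i\<in>UNIV. \<omega> p ((\<lambda>j. Y j p)(i := lie_bracket A X (Y i) p)))"

lemma vfields_at_upd: "(\<lambda>j. (Y(i := Z)) j q) = (\<lambda>j. Y j q)(i := Z q)"
  by auto

text \<open>
  Linearity over the smooth functions in the slot \<open>k\<close>. The derivatives \<open>X p (a j)\<close> of the coefficients
  occur twice and cancel: in the derivative of \<open>\<omega>(Y)\<close> by the product rule, and in
  the summand \<open>i = k\<close> because \<open>[X, a Z] = a [X, Z] + X(a) Z\<close>.
\<close>

lemma lie_form_along_slot:
  fixes \<omega> :: "('a, 'k::finite) form"
  assumes \<omega>: "smooth_form A \<omega>" and X: "smooth_vfield_on A W X" and p: "p \<in> W"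
    and Y: "\<And>i. smooth_vfield_on A W (Y i)"
    and a: "\<And>j. j \<in> J \<Longrightarrow> smooth_fun_on A W (a j)" and Z: "\<And>j. j \<in> J \<Longrightarrow> smooth_vfield_on A W (Z j)"
    and J: "finite J"
    and eq: "\<And>q. q \<in> W \<Longrightarrow> Y k q = (\<lambda>h. \<Sum>j\<in>J. a j q * Z j q h)"
  shows "lie_form_along X \<omega> Y p = (\<Sum>j\<in>J. a j p * lie_form_along X \<omega> (Y(k := Z j)) p)"
proof -
  note W = vfield_open[OF X]
  note Xp = vfield_tangent[OF X p]
  have Yq: "range (\<lambda>i. Y i q) \<subseteq> tangent_space A q" if "q \<in> W" for q
    using vfield_tangent[OF Y that] by blast
  have Zq: "Z j q \<in> tangent_space A q" if "j \<in> J" "q \<in> W" for j q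
    by (rule vfield_tangent[OF Z[OF that(1)] that(2)])
  have br: "lie_bracket A X (Y i) p \<in> tangent_space A p" for i
    by (rule lie_bracket_tangent[OF X Y p])
  have brZ: "lie_bracket A X (Z j) p \<in> tangent_space A p" if "j \<in> J" for j
    by (rule lie_bracket_tangent[OF X Z[OF that] p])
  have upd: "(\<lambda>i. Y i q) = (\<lambda>i. Y i q)(k := (\<lambda>h. \<Sum>j\<in>J. a j q * Z j q h))" if "q \<in> W" for q
    using eq[OF that] by auto
  have val: "\<omega> q (\<lambda>i. Y i q) = (\<Sum>j\<in>J. a j q * \<omega> q ((\<lambda>i. Y i q)(k := Z j q)))" if q: "q \<in> W" for q
    by (subst upd[OF q], rule form_sum[OF \<omega> Yq[OF q] J]) (rule Zq[OF _ q])
  have s: "smooth_fun_on A W (\<lambda>q. \<omega> q ((\<lambda>i. Y i q)(k := Z j q)))" if "j \<in> J" for j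
  proof -
    have "smooth_vfield_on A W ((Y(k := Z j)) i)" for i using Y Z[OF that] by simp
    from form_smooth[OF \<omega> W, of "Y(k := Z j)", OF this] show ?thesis unfolding vfields_at_upd .
  qed
  have "X p (\<lambda>q. \<omega> q (\<lambda>i. Y i q)) = X p (\<lambda>q. \<Sum>j\<in>J. a j q * \<omega> q ((\<lambda>i. Y i q)(k := Z j q)))"
    by (rule tangent_cong[OF Xp form_smooth[OF \<omega> W Y] p val])
  also have "\<dots> = (\<Sum>j\<in>J. X p (\<lambda>q. a j q * \<omega> q ((\<lambda>i. Y i q)(k := Z j q))))"
    by (rule tangent_sum[OF Xp p W]) (intro smooth_fun_on_mult a s)
  also have "\<dots> = (\<Sum>j\<in>J. a j p * X p (\<lambda>q. \<omega> q ((\<lambda>i. Y i q)(k := Z j q)))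
      + X p (a j) * \<omega> p ((\<lambda>i. Y i p)(k := Z j p)))"
    by (intro sum.cong refl) (simp add: tangent_mult[OF Xp a s p])
  finally have first: "X p (\<lambda>q. \<omega> q (\<lambda>i. Y i q)) =
      (\<Sum>j\<in>J. a j p * X p (\<lambda>q. \<omega> q ((\<lambda>i. Y i q)(k := Z j q))))
      + (\<Sum>j\<in>J. X p (a j) * \<omega> p ((\<lambda>i. Y i p)(k := Z j p)))"
    by (simp add: sum.distrib)
  \<comment> \<open>the summands \<open>i \<noteq> k\<close> and \<open>i = k\<close> of the correction term\<close>
  have other: "\<omega> p ((\<lambda>j. Y j p)(i := lie_bracket A X (Y i) p)) =
      (\<Sum>j\<in>J. a j p * \<omega> p ((\<lambda>i. Y i p)(k := Z j p, i := lie_bracket A X (Y i) p)))" if i: "i \<noteq> k" for i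
  proof -
    let ?v = "(\<lambda>j. Y j p)(i := lie_bracket A X (Y i) p)"
    have r: "range ?v \<subseteq> tangent_space A p" using Yq[OF p] br by auto
    have "?v = ?v(k := (\<lambda>h. \<Sum>j\<in>J. a j p * Z j p h))" using i eq[OF p] by auto
    then have "\<omega> p ?v = \<omega> p (?v(k := (\<lambda>h. \<Sum>j\<in>J. a j p * Z j p h)))" by simp
    also have "\<dots> = (\<Sum>j\<in>J. a j p * \<omega> p (?v(k := Z j p)))"
      by (rule form_sum[OF \<omega> r J]) (rule Zq[OF _ p])
    finally have "\<omega> p ?v = (\<Sum>j\<in>J. a j p * \<omega> p (?v(k := Z j p)))" .
    then show ?thesis using i by (simp only: fun_upd_twist[OF i])
  qed
  have same: "\<omega> p ((\<lambda>j. Y j p)(k := lie_bracket A X (Y k) p)) =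
      (\<Sum>j\<in>J. a j p * \<omega> p ((\<lambda>i. Y i p)(k := lie_bracket A X (Z j) p)))
      + (\<Sum>j\<in>J. X p (a j) * \<omega> p ((\<lambda>i. Y i p)(k := Z j p)))"
  proof -
    let ?B = "\<lambda>h. \<Sum>j\<in>J. a j p * lie_bracket A X (Z j) p h" and ?C = "\<lambda>h. \<Sum>j\<in>J. X p (a j) * Z j p h"
    have B: "?B \<in> tangent_space A p" by (rule tangent_space_sum) (rule brZ)
    have C: "?C \<in> tangent_space A p" by (rule tangent_space_sum) (rule Zq[OF _ p])
    have "lie_bracket A X (Y k) p = lie_bracket A X (\<lambda>q h. \<Sum>j\<in>J. a j q * Z j q h) p"
      by (rule lie_bracket_cong[OF X Y p eq])
    also have "\<dots> = (\<lambda>h. ?B h + ?C h)" by (rule lie_bracket_sum[OF X Z a p])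
    finally have "lie_bracket A X (Y k) p = (\<lambda>h. 1 * ?B h + 1 * ?C h)" by simp
    then have "\<omega> p ((\<lambda>j. Y j p)(k := lie_bracket A X (Y k) p)) =
        1 * \<omega> p ((\<lambda>j. Y j p)(k := ?B)) + 1 * \<omega> p ((\<lambda>j. Y j p)(k := ?C))"
      using alternating_linear[OF form_alternating[OF \<omega>] Yq[OF p] B C, of k 1 1] by (simp only:)
    also have "\<omega> p ((\<lambda>j. Y j p)(k := ?B)) = (\<Sum>j\<in>J. a j p * \<omega> p ((\<lambda>i. Y i p)(k := lie_bracket A X (Z j) p)))"
      by (rule form_sum[OF \<omega> Yq[OF p] J]) (rule brZ)
    also have "\<omega> p ((\<lambda>j. Y j p)(k := ?C)) = (\<Sum>j\<in>J. X p (a j) * \<omega> p ((\<lambda>i. Y i p)(k := Z j p)))"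
      by (rule form_sum[OF \<omega> Yq[OF p] J]) (rule Zq[OF _ p])
    finally show ?thesis by (simp only: mult_1)
  qed
  have along: "lie_form_along X \<omega> (Y(k := Z j)) p = X p (\<lambda>q. \<omega> q ((\<lambda>i. Y i q)(k := Z j q)))
      - \<omega> p ((\<lambda>i. Y i p)(k := lie_bracket A X (Z j) p))
      - (\<Sum>i\<in>UNIV - {k}. \<omega> p ((\<lambda>i. Y i p)(k := Z j p, i := lie_bracket A X (Y i) p)))" for j
  proof -
    have "(\<Sum>i\<in>UNIV - {k}. \<omega> p ((\<lambda>i. Y i p)(k := Z j p, i := lie_bracket A X ((Y(k := Z j)) i) p))) =
      (\<Sum>i\<in>UNIV - {k}. \<omega> p ((\<lambda>i. Y i p)(k := Z j p, i := lie_bracket A X (Y i) p)))"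
      by (rule sum.cong) auto
    then show ?thesis
      unfolding lie_form_along_def vfields_at_upd
      by (subst sum.remove[of UNIV k]) auto
  qed
  have "lie_form_along X \<omega> Y p = X p (\<lambda>q. \<omega> q (\<lambda>i. Y i q))
      - \<omega> p ((\<lambda>j. Y j p)(k := lie_bracket A X (Y k) p))
      - (\<Sum>i\<in>UNIV - {k}. \<omega> p ((\<lambda>j. Y j p)(i := lie_bracket A X (Y i) p)))"
    unfolding lie_form_along_def by (subst sum.remove[of UNIV k]) auto
  also have "(\<Sum>i\<in>UNIV - {k}. \<omega> p ((\<lambda>j. Y j p)(i := lie_bracket A X (Y i) p))) =
      (\<Sum>i\<in>UNIV - {k}. \<Sum>j\<in>J. a j p * \<omega> p ((\<lambda>i. Y i p)(k := Z j p, i := lie_bracket A X (Y i) p)))"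
    by (rule sum.cong[OF refl], rule other) simp
  also have "\<dots> = (\<Sum>j\<in>J. a j p * (\<Sum>i\<in>UNIV - {k}. \<omega> p ((\<lambda>i. Y i p)(k := Z j p, i := lie_bracket A X (Y i) p))))"
    unfolding sum_distrib_left by (rule sum.swap)
  finally show ?thesis
    unfolding first same along right_diff_distrib sum_subtractf by simp
qed

text \<open>
  The right-hand side involves \<open>Z\<close> only through its value at \<open>p\<close>; this is where tensoriality comes from.
\<close>

lemma lie_form_along_frame:
  fixes \<omega> :: "('a, 'k::finite) form"
  assumes \<omega>: "smooth_form A \<omega>" and X: "smooth_vfield_on A W X" and p: "p \<in> W"
    and Y: "\<And>i. smooth_vfield_on A W (Y i)" and Z: "smooth_vfield_on A W Z"
    and frame: "frame_on W E x"
  shows "lie_form_along X \<omega> (Y(k := Z)) p = (\<Sum>j\<in>UNIV. Z p (x j) * lie_form_along X \<omega> (Y(k := E j)) p)"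
proof -
  have "lie_form_along X \<omega> (Y(k := Z)) p =
    (\<Sum>j\<in>UNIV. (\<lambda>q. Z q (x j)) p * lie_form_along X \<omega> ((Y(k := Z))(k := E j)) p)"
  proof (rule lie_form_along_slot[OF \<omega> X p])
    show "smooth_vfield_on A W ((Y(k := Z)) i)" for i using Y Z by simp
    show "smooth_fun_on A W (\<lambda>q. Z q (x j))" for j by (rule vfield_smooth[OF Z subset_refl frame_coord[OF frame]])
    show "smooth_vfield_on A W (E j)" for j by (rule frame_vfield[OF frame])
    show "(Y(k := Z)) k q = (\<lambda>h. \<Sum>j\<in>UNIV. Z q (x j) * E j q h)" if "q \<in> W" for q
      using frame_expansion[OF frame that vfield_tangent[OF Z that]] by simp
  qed simp
  then show ?thesis by simp
qed

text \<open>
  The fields are exchanged one slot at a time, each time by comparing the expansions in a common frame.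
\<close>

lemma lie_form_along_pointwise:
  fixes \<omega> :: "('a, 'k::finite) form"
  assumes \<omega>: "smooth_form A \<omega>" and X: "smooth_vfield_on A W X" and p: "p \<in> W"
    and Y: "\<And>i. smooth_vfield_on A W (Y i)" and Z: "\<And>i. smooth_vfield_on A W (Z i)"
    and eq: "\<And>i. Y i p = Z i p"
  shows "lie_form_along X \<omega> Y p = lie_form_along X \<omega> Z p"
proof -
  obtain U E x where U: "p \<in> U" "frame_on U E x" by (rule local_frame)
  define V where "V = U \<inter> W"
  have V: "open V" "p \<in> V" "V \<subseteq> U" "V \<subseteq> W"
    using vfield_open[OF X] vfield_open[OF frame_vfield[OF U(2)]] p U(1) unfolding V_def by auto
  note restr = vfield_subset[OF _ V(1) V(4)]
  let ?M = "\<lambda>I i. if i \<in> I then Z i else Y i"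
  have "lie_form_along X \<omega> (?M I) p = lie_form_along X \<omega> Y p" if "finite I" for I
    using that
  proof (induction I rule: finite_induct)
    case (insert k I)
    have M: "smooth_vfield_on A V (?M I i)" for i using restr[OF Y] restr[OF Z] by simp
    have step: "lie_form_along X \<omega> ((?M I)(k := Q)) p =
        (\<Sum>j\<in>UNIV. Q p (x j) * lie_form_along X \<omega> ((?M I)(k := E j)) p)"
      if Q: "smooth_vfield_on A V Q" for Q
      by (rule lie_form_along_frame[OF \<omega> restr[OF X] V(2) _ Q frame_subset[OF U(2) V(1,3)]]) (rule M)
    have "?M (insert k I) = (?M I)(k := Z k)" and "?M I = (?M I)(k := Y k)" using insert.hyps by auto
    moreover have "lie_form_along X \<omega> ((?M I)(k := Z k)) p = lie_form_along X \<omega> ((?M I)(k := Y k)) p"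
      using step[OF restr[OF Z[of k]]] step[OF restr[OF Y[of k]]] by (simp add: eq)
    ultimately show ?case using insert.IH by simp
  qed simp
  from this[of UNIV] show ?thesis by simp
qed

text \<open>
  The definite description in \<open>lie_form\<close> is justified: any choice of extensions gives the same value.
\<close>

lemma lie_form_eq_along:
  fixes \<omega> :: "('a, 'k::finite) form"
  assumes \<omega>: "smooth_form A \<omega>" and X: "smooth_vfield_on A UNIV X" and p: "p \<in> W"
    and Y: "\<And>i. smooth_vfield_on A W (Y i)"
  shows "lie_form A X \<omega> p (\<lambda>i. Y i p) = lie_form_along X \<omega> Y p"
  unfolding lie_form_def lie_form_along_def[symmetric]
proof (rule the_equality)
  show "\<forall>V Z. p \<in> V \<and> (\<forall>i. smooth_vfield_on A V (Z i)) \<and> (\<forall>i. Z i p = Y i p) \<longrightarrow>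
    lie_form_along X \<omega> Y p = lie_form_along X \<omega> Z p"
  proof (intro allI impI, elim conjE)
    fix V Z assume V: "p \<in> V" and Z: "\<forall>i. smooth_vfield_on A V (Z i)" and eq: "\<forall>i. Z i p = Y i p"
    have o: "open (V \<inter> W)" using vfield_open[OF Y] vfield_open Z by blast
    show "lie_form_along X \<omega> Y p = lie_form_along X \<omega> Z p"
    proof (rule lie_form_along_pointwise[OF \<omega> vfield_subset[OF X o]])
      show "smooth_vfield_on A (V \<inter> W) (Y i)" for i by (rule vfield_subset[OF Y o]) simp
      show "smooth_vfield_on A (V \<inter> W) (Z i)" for i by (rule vfield_subset[OF spec[OF Z] o]) simp
    qed (use V p eq in auto)
  qed
  show "c = lie_form_along X \<omega> Y p"
    if "\<forall>V Z. p \<in> V \<and> (\<forall>i. smooth_vfield_on A V (Z i)) \<and> (\<forall>i. Z i p = Y i p) \<longrightarrow>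
      c = lie_form_along X \<omega> Z p" for c
    using that p Y by blast
qed

text \<open>
  Tangent vectors at \<open>p\<close> are extended to fields by keeping their coefficients in a frame constant; equal
  vectors then have equal extensions. Linearity is visible in the expansion \<open>lie_form_along_frame\<close>. If the
  arguments in the slots \<open>i\<close> and \<open>j\<close> agree, \<open>\<omega>(Y)\<close> vanishes near \<open>p\<close>, and of the correction terms
  only the \<open>i\<close>-th and the \<open>j\<close>-th survive; they differ by a transposition and cancel.
\<close>

lemma lie_form_alternating:
  fixes \<omega> :: "('a, 'k::finite) form"
  assumes \<omega>: "smooth_form A \<omega>" and X: "smooth_vfield_on A UNIV X"
  shows "alternating_multilinear (tangent_space A p) (lie_form A X \<omega> p)"
proof -
  obtain U E x where U: "p \<in> U" "frame_on U E x" by (rule local_frame)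
  have o: "open U" by (rule vfield_open[OF frame_vfield[OF U(2)]])
  note XU = vfield_subset[OF X o subset_UNIV]
  define ext where "ext v = (\<lambda>q h. \<Sum>i\<in>UNIV. v (x i) * E i q h)" for v :: "'a tvec"
  have ext_smooth: "smooth_vfield_on A U (ext v)" for v
    unfolding ext_def by (rule vfield_sum[OF o smooth_fun_on_const[OF o] frame_vfield[OF U(2)]])
  have ext_p: "ext v p = v" if "v \<in> tangent_space A p" for v
    unfolding ext_def using frame_expansion[OF U(2,1) that] by simp
  have lf: "lie_form A X \<omega> p v = lie_form_along X \<omega> (\<lambda>i. ext (v i)) p" if "range v \<subseteq> tangent_space A p" for v
  proof -
    have "(\<lambda>i. ext (v i) p) = v" using that ext_p by auto
    then show ?thesis using lie_form_eq_along[OF \<omega> X U(1) ext_smooth, of v] by simp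
  qed
  have lin: "lie_form A X \<omega> p (v(i := u)) =
      (\<Sum>j\<in>UNIV. u (x j) * lie_form_along X \<omega> ((\<lambda>i. ext (v i))(i := E j)) p)"
    if v: "range v \<subseteq> tangent_space A p" and u: "u \<in> tangent_space A p" for v i u
  proof -
    have r: "range (v(i := u)) \<subseteq> tangent_space A p" using v u by auto
    have "(\<lambda>k. ext ((v(i := u)) k)) = (\<lambda>k. ext (v k))(i := ext u)" by auto
    then have "lie_form A X \<omega> p (v(i := u)) = lie_form_along X \<omega> ((\<lambda>k. ext (v k))(i := ext u)) p"
      using lf[OF r] by simp
    also have "\<dots> = (\<Sum>j\<in>UNIV. ext u p (x j) * lie_form_along X \<omega> ((\<lambda>i. ext (v i))(i := E j)) p)"
      by (rule lie_form_along_frame[OF \<omega> XU U(1) ext_smooth ext_smooth U(2)])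
    finally show ?thesis unfolding ext_p[OF u] .
  qed
  have alt: "lie_form A X \<omega> p v = 0"
    if v: "range v \<subseteq> tangent_space A p" and ij: "i \<noteq> j" and eq: "v i = v j" for v i j
  proof -
    let ?Y = "\<lambda>i. ext (v i)"
    have Yq: "range (\<lambda>i. ?Y i q) \<subseteq> tangent_space A q" if "q \<in> U" for q
      using vfield_tangent[OF ext_smooth that] by blast
    have "X p (\<lambda>q. \<omega> q (\<lambda>i. ?Y i q)) = X p (\<lambda>q. 0)"
    proof (rule tangent_cong[OF vfield_tangent[OF X UNIV_I] form_smooth[OF \<omega> o ext_smooth] U(1)])
      show "\<omega> q (\<lambda>i. ?Y i q) = 0" if "q \<in> U" for q
        by (rule alternating_repeat[OF form_alternating[OF \<omega>] Yq[OF that] ij]) (simp add: eq)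
    qed
    then have first: "X p (\<lambda>q. \<omega> q (\<lambda>i. ?Y i q)) = 0"
      by (simp add: tangent_const[OF vfield_tangent[OF X UNIV_I]])
    let ?b = "\<lambda>k. lie_bracket A X (?Y k) p"
    let ?t = "\<lambda>k. \<omega> p ((\<lambda>k. ?Y k p)(k := ?b k))"
    have b: "?b k \<in> tangent_space A p" for k by (rule lie_bracket_tangent[OF XU ext_smooth U(1)])
    have zero: "?t k = 0" if "k \<noteq> i" "k \<noteq> j" for k
      by (rule alternating_repeat[OF form_alternating[OF \<omega>] _ ij]) (use Yq[OF U(1)] b that eq in auto)
    have "?t j = \<omega> p (((\<lambda>k. ?Y k p)(i := ?b i))(i := ((\<lambda>k. ?Y k p)(i := ?b i)) j, j := ((\<lambda>k. ?Y k p)(i := ?b i)) i))"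
      by (rule arg_cong[of _ _ "\<omega> p"]) (use ij eq in auto)
    also have "\<dots> = - ?t i"
      by (rule alternating_swap[OF form_alternating[OF \<omega>] _ ij tangent_space_lincomb]) (use Yq[OF U(1)] b in auto)
    finally have ji: "?t j = - ?t i" .
    have "(\<Sum>k\<in>UNIV. ?t k) = (\<Sum>k\<in>{i, j}. ?t k)"
      by (rule sum.mono_neutral_right) (auto intro: zero)
    also have "\<dots> = ?t i + ?t j" using ij by simp
    also have "\<dots> = 0" using ji by linarith
    finally show ?thesis unfolding lf[OF v] lie_form_along_def first by simp
  qed
  show ?thesis
    unfolding alternating_multilinear_def
  proof (intro conjI allI impI; elim conjE)
    fix v :: "'k \<Rightarrow> 'a tvec" and i u u' a b
    assume v: "range v \<subseteq> tangent_space A p" and u: "u \<in> tangent_space A p" "u' \<in> tangent_space A p"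
    show "lie_form A X \<omega> p (v(i := (\<lambda>h. a * u h + b * u' h))) =
        a * lie_form A X \<omega> p (v(i := u)) + b * lie_form A X \<omega> p (v(i := u'))"
      unfolding lin[OF v u(1)] lin[OF v u(2)] lin[OF v tangent_space_lincomb[OF u]]
      by (simp only: sum_distrib_left sum.distrib[symmetric]) (simp add: algebra_simps)
  qed (rule alt)
qed

end

section \<open>Divergence with respect to a volume form\<close>

locale volume_manifold = smooth_manifold A
  for A :: "('a::{t2_space, second_countable_topology}, 'n::finite) chart set" +
  fixes \<Omega> :: "('a, 'n) form"
  assumes volume: "volume_form A \<Omega>"
begin

definition vol :: "('n \<Rightarrow> 'a vfield) \<Rightarrow> 'a \<Rightarrow> real" where
  "vol Y q = \<Omega> q (\<lambda>i. Y i q)"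

lemma volume_smooth_form: "smooth_form A \<Omega>"
  using volume unfolding volume_form_def by blast

lemmas volume_alternating = form_alternating[OF volume_smooth_form]

lemma vol_smooth:
  "open W \<Longrightarrow> (\<And>i. smooth_vfield_on A W (Y i)) \<Longrightarrow> smooth_fun_on A W (vol Y)"
  unfolding vol_def[abs_def] by (rule form_smooth[OF volume_smooth_form])

text \<open>
  Only the values at \<open>p\<close> have to be related linearly, so \<open>Z\<close> can be a bracket that is known pointwise.
\<close>

lemma vol_slot_linear:
  assumes "\<And>i. Y i p \<in> tangent_space A p" "P p \<in> tangent_space A p" "Q p \<in> tangent_space A p"
    and "Z p = (\<lambda>h. a * P p h + b * Q p h)"
  shows "vol (Y(i := Z)) p = a * vol (Y(i := P)) p + b * vol (Y(i := Q)) p"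
  unfolding vol_def vfields_at_upd assms(4)
  by (rule alternating_linear[OF volume_alternating _ assms(2,3)]) (use assms(1) in blast)

lemma volume_nonzero_on_frame:
  assumes "frame_on W E x" "p \<in> W"
  shows "vol E p \<noteq> 0"
proof
  assume "vol E p = 0"
  obtain v where v: "range v \<subseteq> tangent_space A p" "\<Omega> p v \<noteq> 0"
    using volume unfolding volume_form_def by blast
  have "\<Omega> p v = 0"
  proof (rule alternating_eq_zero_if_zero_on_basis[OF volume_alternating _ _ tangent_space_zero tangent_space_lincomb _ v(1)])
    show "range (\<lambda>i. E i p) \<subseteq> tangent_space A p"
      using vfield_tangent[OF frame_vfield[OF assms(1)] assms(2)] by blast
    show "\<Omega> p (\<lambda>i. E i p) = 0" using \<open>vol E p = 0\<close> unfolding vol_def .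
    show "\<exists>a. u = (\<lambda>h. \<Sum>j\<in>UNIV. a j * E j p h)" if "u \<in> tangent_space A p" for u
      using frame_expansion[OF assms that] by (intro exI[of _ "\<lambda>j. u (x j)"])
  qed
  with v(2) show False ..
qed

text \<open>
  Choose \<open>c\<close> such that \<open>L\<^sub>X \<Omega> - c \<Omega>\<close> vanishes on a frame; being alternating, it vanishes identically.
\<close>

lemma lie_form_proportional:
  assumes X: "smooth_vfield_on A UNIV X"
  shows "\<exists>c. \<forall>v. range v \<subseteq> tangent_space A p \<longrightarrow> lie_form A X \<Omega> p v = c * \<Omega> p v"
proof -
  obtain U E x where U: "p \<in> U" "frame_on U E x" by (rule local_frame)
  let ?e = "\<lambda>i. E i p"
  have e: "range ?e \<subseteq> tangent_space A p"
    using vfield_tangent[OF frame_vfield[OF U(2)] U(1)] by blast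
  have nz: "\<Omega> p ?e \<noteq> 0" using volume_nonzero_on_frame[OF U(2,1)] unfolding vol_def .
  define c where "c = lie_form A X \<Omega> p ?e / \<Omega> p ?e"
  let ?w = "\<lambda>v. lie_form A X \<Omega> p v - c * \<Omega> p v"
  note L = lie_form_alternating[OF volume_smooth_form X, of p]
  have "alternating_multilinear (tangent_space A p) ?w"
    unfolding alternating_multilinear_def
  proof (intro conjI allI impI; elim conjE)
    fix v :: "'n \<Rightarrow> 'a tvec" and i u u' a b
    assume v: "range v \<subseteq> tangent_space A p" and u: "u \<in> tangent_space A p" "u' \<in> tangent_space A p"
    show "?w (v(i := (\<lambda>h. a * u h + b * u' h))) = a * ?w (v(i := u)) + b * ?w (v(i := u'))"
      unfolding alternating_linear[OF L v u] alternating_linear[OF volume_alternating v u] by (simp add: algebra_simps)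
  next
    fix v :: "'n \<Rightarrow> 'a tvec" and i j
    assume "range v \<subseteq> tangent_space A p" "i \<noteq> j" "v i = v j"
    then show "?w v = 0"
      using alternating_repeat[OF L] alternating_repeat[OF volume_alternating] by simp
  qed
  moreover have "?w ?e = 0" using nz unfolding c_def by simp
  moreover have "\<exists>a. u = (\<lambda>h. \<Sum>j\<in>UNIV. a j * E j p h)" if "u \<in> tangent_space A p" for u
    using frame_expansion[OF U(2,1) that] by (intro exI[of _ "\<lambda>j. u (x j)"])
  ultimately have "?w v = 0" if "range v \<subseteq> tangent_space A p" for v
    using alternating_eq_zero_if_zero_on_basis[OF _ e _ tangent_space_zero tangent_space_lincomb _ that] by blast
  then show ?thesis by (intro exI[of _ c]) simp
qed

lemma lie_form_eq_divergence:
  assumes X: "smooth_vfield_on A UNIV X" and v: "range v \<subseteq> tangent_space A p"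
  shows "lie_form A X \<Omega> p v = divergence A \<Omega> X p * \<Omega> p v"
proof -
  let ?P = "\<lambda>g. \<forall>p v. range v \<subseteq> tangent_space A p \<longrightarrow> lie_form A X \<Omega> p v = g p * \<Omega> p v"
  have "\<exists>g. \<forall>p v. range v \<subseteq> tangent_space A p \<longrightarrow> lie_form A X \<Omega> p v = g p * \<Omega> p v"
    using lie_form_proportional[OF X] by (intro choice allI)
  then obtain g where g: "?P g" by blast
  have unique: "g' = g" if "?P g'" for g'
  proof
    fix p
    obtain v where v: "range v \<subseteq> tangent_space A p" "\<Omega> p v \<noteq> 0"
      using volume unfolding volume_form_def by blast
    have "g' p * \<Omega> p v = g p * \<Omega> p v" using g that v(1) by metis
    then show "g' p = g p" using v(2) by simp
  qed
  have "?P (divergence A \<Omega> X)"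
    unfolding divergence_def by (rule theI[of ?P, OF g unique])
  then show ?thesis using v by blast
qed

text \<open>
  The working form of the definitions of Lie derivative and divergence; all later rules follow from it.
\<close>

lemma derivative_of_vol:
  assumes X: "smooth_vfield_on A UNIV X" and Y: "\<And>i. smooth_vfield_on A W (Y i)" and p: "p \<in> W"
  shows "X p (vol Y) = divergence A \<Omega> X p * vol Y p + (\<Sum>i\<in>UNIV. vol (Y(i := lie_bracket A X (Y i))) p)"
proof -
  have r: "range (\<lambda>i. Y i p) \<subseteq> tangent_space A p" using vfield_tangent[OF Y p] by blast
  have "lie_form_along X \<Omega> Y p = divergence A \<Omega> X p * \<Omega> p (\<lambda>i. Y i p)"
    using lie_form_eq_along[OF volume_smooth_form X p, of Y, OF Y] lie_form_eq_divergence[OF X r] by simp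
  then show ?thesis
    unfolding lie_form_along_def vol_def[abs_def] vfields_at_upd by linarith
qed

lemma derivative_of_frame_vol:
  assumes "smooth_vfield_on A UNIV X" "frame_on W E x" "p \<in> W"
  shows "X p (vol E) = divergence A \<Omega> X p * vol E p + (\<Sum>i\<in>UNIV. vol (E(i := lie_bracket A X (E i))) p)"
  by (rule derivative_of_vol[OF assms(1) _ assms(3)]) (rule frame_vfield[OF assms(2)])

text \<open>
  Near any point, solve \<open>derivative_of_frame_vol\<close> for the divergence; \<open>\<Omega>\<close> vanishes nowhere on a frame.
\<close>

lemma divergence_smooth:
  assumes X: "smooth_vfield_on A UNIV X"
  shows "smooth_fun_on A UNIV (divergence A \<Omega> X)"
proof (rule smooth_fun_on_local)
  fix p
  obtain U E x where U: "p \<in> U" "frame_on U E x" by (rule local_frame)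
  note E = frame_vfield[OF U(2)]
  have o: "open U" by (rule vfield_open[OF E])
  note XU = vfield_subset[OF X o subset_UNIV]
  have B: "smooth_vfield_on A U ((E(i := lie_bracket A X (E i))) j)" for i j
    using E lie_bracket_smooth[OF XU E] by simp
  have "smooth_fun_on A U (\<lambda>q. (X q (vol E) - (\<Sum>i\<in>UNIV. vol (E(i := lie_bracket A X (E i))) q)) / vol E q)"
    by (intro smooth_fun_on_divide smooth_fun_on_diff smooth_fun_on_sum o vol_smooth[OF o B] vol_smooth[OF o E]
        vfield_smooth[OF XU subset_refl] volume_nonzero_on_frame[OF U(2)])
  then have "smooth_fun_on A U (divergence A \<Omega> X)"
  proof (rule smooth_fun_on_cong)
    fix q assume q: "q \<in> U"
    show "(X q (vol E) - (\<Sum>i\<in>UNIV. vol (E(i := lie_bracket A X (E i))) q)) / vol E q = divergence A \<Omega> X q"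
      using derivative_of_frame_vol[OF X U(2) q] volume_nonzero_on_frame[OF U(2) q] by simp
  qed
  then show "smooth_near A p (divergence A \<Omega> X)" using U(1) by (rule smooth_nearI)
qed simp

lemma divergence_add:
  assumes X: "smooth_vfield_on A UNIV X" and Y: "smooth_vfield_on A UNIV Y"
  shows "divergence A \<Omega> (vf_add X Y) p = divergence A \<Omega> X p + divergence A \<Omega> Y p"
proof -
  obtain U E x where U: "p \<in> U" "frame_on U E x" by (rule local_frame)
  note E = frame_vfield[OF U(2)]
  have o: "open U" by (rule vfield_open[OF E])
  note S = vfield_add[OF X Y]
  note XU = vfield_subset[OF X o subset_UNIV] and YU = vfield_subset[OF Y o subset_UNIV]
    and SU = vfield_subset[OF S o subset_UNIV]
  have slot: "vol (E(i := lie_bracket A (vf_add X Y) (E i))) p =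
      vol (E(i := lie_bracket A X (E i))) p + vol (E(i := lie_bracket A Y (E i))) p" for i
  proof -
    note bX = lie_bracket_tangent[OF XU E U(1)] and bY = lie_bracket_tangent[OF YU E U(1)]
    have br: "lie_bracket A (vf_add X Y) (E i) p = (\<lambda>h. 1 * lie_bracket A X (E i) p h + 1 * lie_bracket A Y (E i) p h)"
    proof (rule tangent_eqI[OF lie_bracket_tangent[OF SU E U(1)] tangent_space_lincomb[OF bX bY] o U(1)])
      fix V h assume V: "p \<in> V" "V \<subseteq> U" and h: "smooth_fun_on A V h"
      show "lie_bracket A (vf_add X Y) (E i) p h = 1 * lie_bracket A X (E i) p h + 1 * lie_bracket A Y (E i) p h"
        using tangent_add[OF vfield_tangent[OF E U(1)] vfield_smooth[OF XU V(2) h] vfield_smooth[OF YU V(2) h] V(1)]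
        by (simp add: lie_bracket_apply[OF h V(1)] vf_add_def)
    qed
    have "vol (E(i := lie_bracket A (vf_add X Y) (E i))) p =
        1 * vol (E(i := lie_bracket A X (E i))) p + 1 * vol (E(i := lie_bracket A Y (E i))) p"
      by (rule vol_slot_linear) (rule vfield_tangent[OF E U(1)] bX bY br)+
    then show ?thesis by simp
  qed
  have "divergence A \<Omega> (vf_add X Y) p * vol E p = (divergence A \<Omega> X p + divergence A \<Omega> Y p) * vol E p"
    using derivative_of_frame_vol[OF X U(2,1)] derivative_of_frame_vol[OF Y U(2,1)] derivative_of_frame_vol[OF S U(2,1)]
    unfolding slot sum.distrib vf_add_def[of X Y, THEN fun_cong, THEN fun_cong] by (simp add: algebra_simps)
  then show ?thesis using volume_nonzero_on_frame[OF U(2,1)] by simp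
qed

text \<open>
  Since \<open>[g X, E\<^sub>i] = g [X, E\<^sub>i] - E\<^sub>i(g) X\<close>, compared with \<open>g div X \<Omega>(E)\<close> there is an additional
  \<open>\<Sum>\<^sub>i E\<^sub>i(g) \<Omega>(E\<^sub>1, \<dots>, X, \<dots>, E\<^sub>n)\<close> with \<open>X\<close> in the slot \<open>i\<close>. By Cramer's rule that value of \<open>\<Omega>\<close> is
  the \<open>i\<close>-th coefficient of \<open>X\<close> times \<open>\<Omega>(E)\<close>, and the sum becomes \<open>X(g) \<Omega>(E)\<close>.
\<close>

lemma divergence_scale:
  assumes g: "smooth_fun_on A UNIV g" and X: "smooth_vfield_on A UNIV X"
  shows "divergence A \<Omega> (vf_scale g X) p = g p * divergence A \<Omega> X p + X p g"
proof -
  obtain U E x where U: "p \<in> U" "frame_on U E x" by (rule local_frame)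
  note E = frame_vfield[OF U(2)]
  have o: "open U" by (rule vfield_open[OF E])
  note S = vfield_scale[OF g X]
  note XU = vfield_subset[OF X o subset_UNIV] and SU = vfield_subset[OF S o subset_UNIV]
  note gU = smooth_fun_on_subset[OF g o subset_UNIV]
  note Ep = vfield_tangent[OF E U(1)] and Xp = vfield_tangent[OF XU U(1)]
  have XE: "vol (E(i := X)) p = X p (x i) * vol E p" for i
  proof -
    have r: "range (\<lambda>i. E i p) \<subseteq> tangent_space A p" using Ep by blast
    have "vol (E(i := X)) p = \<Omega> p ((\<lambda>i. E i p)(i := (\<lambda>h. \<Sum>j\<in>UNIV. X p (x j) * E j p h)))"
      unfolding vol_def vfields_at_upd using frame_expansion[OF U(2,1) Xp] by simp
    also have "\<dots> = (\<Sum>j\<in>UNIV. X p (x j) * \<Omega> p ((\<lambda>i. E i p)(i := E j p)))"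
      by (rule form_sum[OF volume_smooth_form r]) (use Ep in auto)
    also have "\<dots> = (\<Sum>j\<in>UNIV. if j = i then X p (x i) * vol E p else 0)"
    proof (rule sum.cong[OF refl])
      fix j
      have "\<Omega> p ((\<lambda>i. E i p)(i := E j p)) = 0" if "j \<noteq> i"
        by (rule alternating_repeat[OF volume_alternating _ that]) (use Ep that in auto)
      moreover have "(\<lambda>i. E i p)(i := E i p) = (\<lambda>i. E i p)" by auto
      ultimately show "X p (x j) * \<Omega> p ((\<lambda>i. E i p)(i := E j p)) = (if j = i then X p (x i) * vol E p else 0)"
        unfolding vol_def by auto
    qed
    finally show ?thesis by simp
  qed
  have slot: "vol (E(i := lie_bracket A (vf_scale g X) (E i))) p =
      g p * vol (E(i := lie_bracket A X (E i))) p - E i p g * (X p (x i) * vol E p)" for i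
  proof -
    note bX = lie_bracket_tangent[OF XU E U(1)]
    have br: "lie_bracket A (vf_scale g X) (E i) p = (\<lambda>h. g p * lie_bracket A X (E i) p h + (- E i p g) * X p h)"
    proof (rule tangent_eqI[OF lie_bracket_tangent[OF SU E U(1)] tangent_space_lincomb[OF bX Xp] o U(1)])
      fix V h assume V: "p \<in> V" "V \<subseteq> U" and h: "smooth_fun_on A V h"
      have gV: "smooth_fun_on A V g" by (rule smooth_fun_on_subset[OF g smooth_fun_on_open[OF h] subset_UNIV])
      show "lie_bracket A (vf_scale g X) (E i) p h = g p * lie_bracket A X (E i) p h + (- E i p g) * X p h"
        using tangent_mult[OF Ep gV vfield_smooth[OF XU V(2) h] V(1)]
        by (simp add: lie_bracket_apply[OF h V(1)] vf_scale_def algebra_simps)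
    qed
    have "vol (E(i := lie_bracket A (vf_scale g X) (E i))) p =
        g p * vol (E(i := lie_bracket A X (E i))) p + (- E i p g) * vol (E(i := X)) p"
      by (rule vol_slot_linear) (rule Ep bX Xp br)+
    then show ?thesis by (simp add: XE)
  qed
  have "X p g = (\<Sum>i\<in>UNIV. X p (x i) * E i p g)"
    using fun_cong[OF frame_expansion[OF U(2,1) Xp], of g] .
  then have Xg: "X p g * vol E p = (\<Sum>i\<in>UNIV. E i p g * (X p (x i) * vol E p))"
    by (simp add: sum_distrib_left sum_distrib_right algebra_simps)
  have "divergence A \<Omega> (vf_scale g X) p * vol E p = (g p * divergence A \<Omega> X p + X p g) * vol E p"
    using derivative_of_frame_vol[OF X U(2,1)] derivative_of_frame_vol[OF S U(2,1)] Xg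
    unfolding slot sum_subtractf sum_distrib_left[symmetric] vf_scale_def[of g X, THEN fun_cong, THEN fun_cong]
    by (simp add: algebra_simps)
  then show ?thesis using volume_nonzero_on_frame[OF U(2,1)] by simp
qed

text \<open>
  The identity \<open>derivative_of_frame_vol\<close> applied to \<open>Y\<close>, and the result differentiated along \<open>X\<close>. Only the
  terms \<open>X (div Y)\<close> and \<open>[X, [Y, E\<^sub>i]]\<close> are not symmetric in \<open>X\<close> and \<open>Y\<close>: the sums over single brackets
  are exchanged with each other, and so are the two indices in the double sum.
\<close>

lemma second_derivative_of_vol:
  assumes X: "smooth_vfield_on A UNIV X" and Y: "smooth_vfield_on A UNIV Y"
    and frame: "frame_on W E x" and p: "p \<in> W"
  shows "X p (\<lambda>q. Y q (vol E)) = X p (divergence A \<Omega> Y) * vol E p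
    + divergence A \<Omega> X p * divergence A \<Omega> Y p * vol E p
    + divergence A \<Omega> Y p * (\<Sum>i\<in>UNIV. vol (E(i := lie_bracket A X (E i))) p)
    + divergence A \<Omega> X p * (\<Sum>i\<in>UNIV. vol (E(i := lie_bracket A Y (E i))) p)
    + (\<Sum>i\<in>UNIV. vol (E(i := lie_bracket A X (lie_bracket A Y (E i)))) p)
    + (\<Sum>i\<in>UNIV. \<Sum>k\<in>UNIV - {i}. vol (E(i := lie_bracket A Y (E i), k := lie_bracket A X (E k))) p)"
proof -
  note E = frame_vfield[OF frame]
  have o: "open W" by (rule vfield_open[OF E])
  note XW = vfield_subset[OF X o subset_UNIV] and YW = vfield_subset[OF Y o subset_UNIV]
  note Xp = vfield_tangent[OF X UNIV_I, of p]
  let ?F = "\<lambda>i. E(i := lie_bracket A Y (E i))"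
  have F: "smooth_vfield_on A W (?F i j)" for i j
    using E lie_bracket_smooth[OF YW E] by simp
  have sF: "smooth_fun_on A W (vol (?F i))" for i by (rule vol_smooth[OF o F])
  have sE: "smooth_fun_on A W (vol E)" by (rule vol_smooth[OF o E])
  have sD: "smooth_fun_on A W (divergence A \<Omega> Y)"
    by (rule smooth_fun_on_subset[OF divergence_smooth[OF Y] o subset_UNIV])
  have "X p (\<lambda>q. Y q (vol E)) = X p (\<lambda>q. divergence A \<Omega> Y q * vol E q + (\<Sum>i\<in>UNIV. vol (?F i) q))"
    by (rule tangent_cong[OF Xp vfield_smooth[OF YW subset_refl sE] p]) (rule derivative_of_frame_vol[OF Y frame])
  also have "\<dots> = X p (\<lambda>q. divergence A \<Omega> Y q * vol E q) + X p (\<lambda>q. \<Sum>i\<in>UNIV. vol (?F i) q)"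
    by (rule tangent_add[OF Xp _ _ p]) (intro smooth_fun_on_mult smooth_fun_on_sum o sD sE sF)+
  also have "X p (\<lambda>q. divergence A \<Omega> Y q * vol E q) =
      divergence A \<Omega> Y p * X p (vol E) + vol E p * X p (divergence A \<Omega> Y)"
    by (rule tangent_mult[OF Xp sD sE p])
  also have "X p (\<lambda>q. \<Sum>i\<in>UNIV. vol (?F i) q) = (\<Sum>i\<in>UNIV. X p (vol (?F i)))"
    by (rule tangent_sum[OF Xp p o sF])
  also have "\<dots> = (\<Sum>i\<in>UNIV. divergence A \<Omega> X p * vol (?F i) p
      + vol (E(i := lie_bracket A X (lie_bracket A Y (E i)))) p
      + (\<Sum>k\<in>UNIV - {i}. vol (E(i := lie_bracket A Y (E i), k := lie_bracket A X (E k))) p))"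
  proof (rule sum.cong[OF refl])
    fix i
    have "(\<Sum>k\<in>UNIV. vol ((?F i)(k := lie_bracket A X (?F i k))) p) =
      vol ((?F i)(i := lie_bracket A X (?F i i))) p + (\<Sum>k\<in>UNIV - {i}. vol ((?F i)(k := lie_bracket A X (?F i k))) p)"
      by (rule sum.remove) auto
    also have "(\<Sum>k\<in>UNIV - {i}. vol ((?F i)(k := lie_bracket A X (?F i k))) p) =
      (\<Sum>k\<in>UNIV - {i}. vol (E(i := lie_bracket A Y (E i), k := lie_bracket A X (E k))) p)"
      by (rule sum.cong) auto
    also have "vol ((?F i)(i := lie_bracket A X (?F i i))) p = vol (E(i := lie_bracket A X (lie_bracket A Y (E i)))) p"
      by simp
    finally have split: "(\<Sum>k\<in>UNIV. vol ((?F i)(k := lie_bracket A X (?F i k))) p) =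
      vol (E(i := lie_bracket A X (lie_bracket A Y (E i)))) p
      + (\<Sum>k\<in>UNIV - {i}. vol (E(i := lie_bracket A Y (E i), k := lie_bracket A X (E k))) p)" .
    show "X p (vol (?F i)) = divergence A \<Omega> X p * vol (?F i) p
      + vol (E(i := lie_bracket A X (lie_bracket A Y (E i)))) p
      + (\<Sum>k\<in>UNIV - {i}. vol (E(i := lie_bracket A Y (E i), k := lie_bracket A X (E k))) p)"
      using derivative_of_vol[OF X, of W "?F i", OF F p] unfolding split by linarith
  qed
  finally show ?thesis
    unfolding derivative_of_frame_vol[OF X frame p] by (simp add: sum.distrib sum_distrib_left algebra_simps)
qed

text \<open>
  Subtract \<open>second_derivative_of_vol\<close> with \<open>X\<close> and \<open>Y\<close> exchanged. By the Jacobi identity the remaining double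
  brackets form the correction terms for \<open>[X, Y]\<close>, so the rest is the divergence of \<open>[X, Y]\<close>.
\<close>

lemma divergence_lie_bracket:
  assumes X: "smooth_vfield_on A UNIV X" and Y: "smooth_vfield_on A UNIV Y"
  shows "divergence A \<Omega> (lie_bracket A X Y) p = X p (divergence A \<Omega> Y) - Y p (divergence A \<Omega> X)"
proof -
  obtain U E x where U: "p \<in> U" "frame_on U E x" by (rule local_frame)
  note E = frame_vfield[OF U(2)]
  have o: "open U" by (rule vfield_open[OF E])
  note XU = vfield_subset[OF X o subset_UNIV] and YU = vfield_subset[OF Y o subset_UNIV]
  have sE: "smooth_fun_on A U (vol E)" by (rule vol_smooth[OF o E])
  let ?d = "\<lambda>P Q i k. vol (E(i := lie_bracket A Q (E i), k := lie_bracket A P (E k))) p"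
  have "(\<Sum>i\<in>UNIV. \<Sum>k\<in>UNIV - {i}. ?d X Y i k) = (\<Sum>k\<in>UNIV. \<Sum>i\<in>UNIV - {k}. ?d X Y i k)"
  proof -
    have "(\<Sum>i\<in>UNIV. \<Sum>k\<in>{k \<in> UNIV. k \<noteq> i}. ?d X Y i k) = (\<Sum>k\<in>UNIV. \<Sum>i\<in>{i \<in> UNIV. k \<noteq> i}. ?d X Y i k)"
      by (rule sum.swap_restrict) auto
    moreover have "{k \<in> UNIV. k \<noteq> i} = UNIV - {i}" "{k \<in> UNIV. i \<noteq> k} = UNIV - {i}" for i :: 'n by auto
    ultimately show ?thesis by (simp only:)
  qed
  also have "\<dots> = (\<Sum>k\<in>UNIV. \<Sum>i\<in>UNIV - {k}. ?d Y X k i)"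
    by (intro sum.cong refl) (simp add: fun_upd_twist)
  finally have swap: "(\<Sum>i\<in>UNIV. \<Sum>k\<in>UNIV - {i}. ?d X Y i k) = (\<Sum>i\<in>UNIV. \<Sum>k\<in>UNIV - {i}. ?d Y X i k)" .
  have slot: "vol (E(i := lie_bracket A (lie_bracket A X Y) (E i))) p =
      vol (E(i := lie_bracket A X (lie_bracket A Y (E i)))) p - vol (E(i := lie_bracket A Y (lie_bracket A X (E i)))) p" for i
  proof -
    note b1 = lie_bracket_tangent[OF XU lie_bracket_smooth[OF YU E] U(1)]
      and b2 = lie_bracket_tangent[OF YU lie_bracket_smooth[OF XU E] U(1)]
    have br: "lie_bracket A (lie_bracket A X Y) (E i) p = (\<lambda>h. 1 * lie_bracket A X (lie_bracket A Y (E i)) p h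
        + (-1) * lie_bracket A Y (lie_bracket A X (E i)) p h)"
      using Jacobi_identity[OF XU YU E U(1)] by simp
    have "vol (E(i := lie_bracket A (lie_bracket A X Y) (E i))) p =
      1 * vol (E(i := lie_bracket A X (lie_bracket A Y (E i)))) p
      + (-1) * vol (E(i := lie_bracket A Y (lie_bracket A X (E i)))) p"
      by (rule vol_slot_linear) (rule vfield_tangent[OF E U(1)] b1 b2 br)+
    then show ?thesis by simp
  qed
  have "lie_bracket A X Y p (vol E) = X p (\<lambda>q. Y q (vol E)) - Y p (\<lambda>q. X q (vol E))"
    by (rule lie_bracket_apply[OF sE U(1)])
  then have "divergence A \<Omega> (lie_bracket A X Y) p * vol E p =
      (X p (divergence A \<Omega> Y) - Y p (divergence A \<Omega> X)) * vol E p"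
    unfolding derivative_of_frame_vol[OF lie_bracket_smooth[OF X Y] U(2,1)] slot sum_subtractf
      second_derivative_of_vol[OF X Y U(2,1)] second_derivative_of_vol[OF Y X U(2,1)] swap
    by (simp add: algebra_simps)
  then show ?thesis using volume_nonzero_on_frame[OF U(2,1)] by simp
qed

section \<open>The first integral\<close>

lemma first_integral_formula:
  assumes X: "smooth_vfield_on A UNIV X" and Y: "smooth_vfield_on A UNIV Y"
    and lam: "smooth_fun_on A UNIV lam" and mu: "smooth_fun_on A UNIV mu" and f: "smooth_fun_on A UNIV f"
    and bracket: "lie_bracket A X Y = vf_add (vf_scale lam X) (vf_scale mu Y)"
    and fX: "\<And>p. divergence A \<Omega> (vf_scale f X) p = 0"
    and fmuY: "\<And>p. divergence A \<Omega> (vf_scale (\<lambda>q. f q * mu q) Y) p = 0"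
    and p: "f p \<noteq> 0"
  shows "X p (\<lambda>q. Y q f / f q + divergence A \<Omega> Y q - lam q) = 0"
proof -
  note Xp = vfield_tangent[OF X UNIV_I, of p] and Yp = vfield_tangent[OF Y UNIV_I, of p]
  note dX = divergence_smooth[OF X] and dY = divergence_smooth[OF Y]
  note sYf = vfield_smooth[OF Y subset_UNIV f]
  let ?U = "{q \<in> UNIV. f q \<noteq> 0}"
  have U: "open ?U" by (rule smooth_fun_on_nonzero_open[OF f])
  have pU: "p \<in> ?U" using p by simp
  note restr = smooth_fun_on_subset[OF _ U subset_UNIV]
  \<comment> \<open>\<open>div (f X) = 0\<close>, in a form that can be differentiated along \<open>Y\<close>\<close>
  have Xf: "X q f = -1 * (f q * divergence A \<Omega> X q)" for q
    using fX[of q] divergence_scale[OF f X] by simp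
  have YXf: "Y p (\<lambda>q. X q f) = -1 * (f p * Y p (divergence A \<Omega> X) + divergence A \<Omega> X p * Y p f)"
  proof -
    have fd: "smooth_fun_on A UNIV (\<lambda>q. f q * divergence A \<Omega> X q)" by (rule smooth_fun_on_mult[OF f dX])
    have "Y p (\<lambda>q. X q f) = Y p (\<lambda>q. -1 * (f q * divergence A \<Omega> X q))"
      by (simp only: Xf)
    also have "\<dots> = -1 * Y p (\<lambda>q. f q * divergence A \<Omega> X q)"
      using tangent_linear[OF Yp fd fd UNIV_I, of "-1" 0] by simp
    finally show ?thesis by (simp only: tangent_mult[OF Yp f dX UNIV_I])
  qed
  \<comment> \<open>the assumption on \<open>[X, Y]\<close>, applied to \<open>f\<close> and under the divergence; then \<open>div (f \<mu> Y) = 0\<close>\<close>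
  have br_f: "X p (\<lambda>q. Y q f) - Y p (\<lambda>q. X q f) = lam p * X p f + mu p * Y p f"
    using lie_bracket_apply[OF f UNIV_I, of X Y p] unfolding bracket by (simp add: vf_add_def vf_scale_def)
  have br_div: "X p (divergence A \<Omega> Y) - Y p (divergence A \<Omega> X) =
      (lam p * divergence A \<Omega> X p + X p lam) + (mu p * divergence A \<Omega> Y p + Y p mu)"
    using divergence_lie_bracket[OF X Y, of p] unfolding bracket
    by (simp add: divergence_add vfield_scale lam mu X Y divergence_scale)
  have third: "f p * mu p * divergence A \<Omega> Y p + (f p * Y p mu + mu p * Y p f) = 0"
    using fmuY[of p] divergence_scale[OF smooth_fun_on_mult[OF f mu] Y, of p] tangent_mult[OF Yp f mu UNIV_I] by simp
  have quot: "smooth_fun_on A ?U (\<lambda>q. Y q f / f q)"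
    by (rule smooth_fun_on_divide[OF restr[OF sYf] restr[OF f]]) simp
  have "X p (\<lambda>q. Y q f / f q + divergence A \<Omega> Y q - lam q) =
      X p (\<lambda>q. Y q f / f q) + X p (divergence A \<Omega> Y) - X p lam"
    by (simp add: tangent_diff[OF Xp smooth_fun_on_add[OF quot restr[OF dY]] restr[OF lam] pU]
        tangent_add[OF Xp quot restr[OF dY] pU])
  also have "X p (\<lambda>q. Y q f / f q) = (f p * X p (\<lambda>q. Y q f) - Y p f * X p f) / (f p * f p)"
    by (rule tangent_divide[OF Xp restr[OF sYf] restr[OF f] pU]) simp
  also have "f p * X p (\<lambda>q. Y q f) - Y p f * X p f =
      f p * (mu p * Y p f - f p * lam p * divergence A \<Omega> X p - f p * Y p (divergence A \<Omega> X))"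
    using br_f unfolding YXf Xf[of p] by (simp add: algebra_simps) algebra
  also have "f p * (mu p * Y p f - f p * lam p * divergence A \<Omega> X p - f p * Y p (divergence A \<Omega> X)) / (f p * f p)
      = mu p * Y p f / f p - lam p * divergence A \<Omega> X p - Y p (divergence A \<Omega> X)"
    using p by (simp add: field_simps)
  also have "mu p * Y p f / f p = - mu p * divergence A \<Omega> Y p - Y p mu"
    using third p by (simp add: field_simps)
  finally show ?thesis using br_div by simp
qed

end

theorem theorem1p1:
  fixes A :: "('a::{t2_space, second_countable_topology}, 'n::finite) chart set"
    and \<Omega> :: "('a, 'n) form"
    and X Y :: "'a vfield"
    and lam mu f :: "'a \<Rightarrow> real"
  assumes "smooth_atlas A"
    and "volume_form A \<Omega>"
    and "smooth_vfield_on A UNIV X"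
    and "smooth_vfield_on A UNIV Y"
    and "smooth_fun_on A UNIV lam"
    and "smooth_fun_on A UNIV mu"
    and "lie_bracket A X Y = vf_add (vf_scale lam X) (vf_scale mu Y)"
    and "integrating_factor A \<Omega> X f"
    and "integrating_factor A \<Omega> Y (\<lambda>p. f p * mu p)"
  shows "first_integral_on A (UNIV - {p. f p = 0}) X
           (\<lambda>p. lie_fun Y f p / f p + divergence A \<Omega> Y p - lam p)"
proof -
  interpret volume_manifold A \<Omega>
    using assms(1,2) by unfold_locales
  have f: "smooth_fun_on A UNIV f" using assms(8) unfolding integrating_factor_def by blast
  have U: "open (UNIV - {p. f p = 0})"
    using smooth_fun_on_nonzero_open[OF f] by (simp add: set_diff_eq)
  note restr = smooth_fun_on_subset[OF _ U subset_UNIV]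
  have "smooth_fun_on A (UNIV - {p. f p = 0}) (\<lambda>p. Y p f / f p + divergence A \<Omega> Y p - lam p)"
    by (intro smooth_fun_on_diff smooth_fun_on_add smooth_fun_on_divide restr f assms(5)
        vfield_smooth[OF assms(4) subset_UNIV f] divergence_smooth[OF assms(4)]) simp
  moreover have "X p (\<lambda>q. Y q f / f q + divergence A \<Omega> Y q - lam q) = 0" if "f p \<noteq> 0" for p
    by (rule first_integral_formula[OF assms(3-6) f assms(7) _ _ that])
      (use assms(8,9) in \<open>auto simp: integrating_factor_def\<close>)
  ultimately show ?thesis unfolding first_integral_on_def lie_fun_def by simp
qed

end
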